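(* For each $n\ge 1$ let $\{P_1,\ldots,P_n\}\subset\mathbb{S}^2$ be the points of the spherical ensemble $\mathcal{X}^{(n)}$. For every $M>0$ (independent of $n$) one has \[\mathbf{D}(\{P_1,\ldots,P_n\})=O\left(n^{1/4}\sqrt{\log n}\right)\] with probability $1-\frac{1}{n^M}$; that is, for every $M>0$ there is a constant $C=C(M)>0$, independent of $n$, such that for all $n\ge 2$, \[\mathbf{P}\left(\mathbf{D}(\{P_1,\ldots,P_n\})\le C\,n^{1/4}\sqrt{\log n}\right)\ge 1-\frac{1}{n^{M}}.\]
   Context: Spherical ensemble. Let $\mathbb{S}^2=\{p\in\mathbb{R}^3:|p|=1\}$ and let $\nu$ be the surface area measure on $\mathbb{S}^2$ (total mass $4\pi$); $|D|$ denotes the area $\nu(D)$ of $D\subset\mathbb{S}^2$. Let $A_n,B_n$ be independent $n\times n$ random matrices with i.i.d. standard complex Gaussian entries, let $\lambda_1,\ldots,\lambda_n$ be the eigenvalues of $A_n^{-1}B_n$, let $g$ be the stereographic projection of $\mathbb{S}^2$ from the north pole onto the plane $\{(t_1,t_2,0)\}\cong\mathbb{C}$, and let $P_i=g^{-1}(\lambda_i)$. Equivalently, in uniform random order, $(P_1,\ldots,P_n)$ has joint density proportional to $\prod_{i<j}|p_i-p_j|^2$ with respect to $\nu^{\otimes n}$ on $(\mathbb{S}^2)^n$, where $|\cdot|$ is the Euclidean norm. The point process is $\mathcal{X}^{(n)}=\sum_{i=1}^n\delta_{P_i}$. Spherical cap discrepancy. A spherical cap is the intersection of $\mathbb{S}^2$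 with a half-space; let $\mathcal{A}$ be the set of all spherical caps. For an $n$-point set $\{x_1,\ldots,x_n\}\subset\mathbb{S}^2$, \[\mathbf{D}(\{x_1,\ldots,x_n\})=\sup_{D\in\mathcal{A}}\left|\sum_{j=1}^n 1_D(x_j)-\frac{n|D|}{4\pi}\right|.\] *)

theory Defs
  imports "HOL-Probability.Probability"
begin

abbreviation S2 :: "(real^3) set" where
  "S2 \<equiv> sphere 0 1"

text \<open>
  The surface area measure on the unit sphere, as a measure whose underlying space is the sphere
  with its Borel sets. It is defined through cones over subsets of the sphere (Folland, Real
  Analysis, Section 2.7): the area of \<open>D\<close> is \<open>3\<close> times the volume of
  \<open>{x. 0 < norm x < 1, x / norm x \<in> D}\<close>. The origin is removed because
  \<open>sgn 0 = 0\<close> is not on the sphere.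
\<close>
definition area_S2 :: "(real^3) measure" where
  "area_S2 =
     scale_measure 3 (distr (restrict_space lborel (ball 0 1 - {0})) (restrict_space borel S2) sgn)"

text \<open>Half-spaces may be open or closed; both kinds are allowed.\<close>
definition halfspaces :: "(real^3) set set" where
  "halfspaces = {{x. a \<bullet> x \<le> b} | a b. a \<noteq> 0} \<union> {{x. a \<bullet> x < b} | a b. a \<noteq> 0}"

definition spherical_caps :: "(real^3) set set" where
  "spherical_caps = {S2 \<inter> H | H. H \<in> halfspaces}"

text \<open>
  The points are \<open>x 0, \<dots>, x (n - 1)\<close>. The supremum is over a nonempty set of
  reals bounded by \<open>n\<close> (\<open>cap_deviation_le\<close> below), so \<open>SUP\<close> has its
  usual meaning.
\<close>
definition cap_discrepancy :: "nat \<Rightarrow> (nat \<Rightarrow> real^3) \<Rightarrow> real" where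
  "cap_discrepancy n x =
     (SUP D\<in>spherical_caps.
        \<bar>(\<Sum>j<n. indicator D (x j)) - real n * measure area_S2 D / (4 * pi)\<bar>)"

text \<open>
  The random points \<open>P 0, \<dots>, P (n - 1)\<close> on \<open>M\<close> are the points, in uniform
  random order, of the spherical ensemble of size \<open>n\<close>: their joint density with respect to
  the \<open>n\<close>-fold product of surface area is proportional to the product of the squared
  Euclidean distances over all pairs. The constant \<open>c\<close> is determined by the total mass
  being 1.
\<close>
definition spherical_ensemble :: "nat \<Rightarrow> 'a measure \<Rightarrow> (nat \<Rightarrow> 'a \<Rightarrow> real^3) \<Rightarrow> bool" where
  "spherical_ensemble n M P \<longleftrightarrow>
     prob_space M \<and>
     (\<exists>c>0. distributed M (\<Pi>\<^sub>M i\<in>{..<n}. area_S2) (\<lambda>\<omega>. \<lambda>i\<in>{..<n}. P i \<omega>)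
        (\<lambda>p. ennreal (c * (\<Prod>j<n. \<Prod>i<j. (norm (p i - p j))\<^sup>2))))"

lemma space_area_S2: "space area_S2 = S2"
  by (simp add: area_S2_def space_scale_measure space_restrict_space)

lemma sets_area_S2: "sets area_S2 = sets (restrict_space borel S2)"
  by (simp add: area_S2_def)

lemma emeasure_area_S2:
  assumes "D \<in> sets borel" "D \<subseteq> S2"
  shows "emeasure area_S2 D = 3 * emeasure lborel {x. 0 < norm x \<and> norm x < 1 \<and> x /\<^sub>R norm x \<in> D}"
proof -
  have "(sgn :: real^3 \<Rightarrow> _) \<in> borel_measurable borel"
    unfolding sgn_div_norm by measurable
  then have sgn: "(sgn :: real^3 \<Rightarrow> _) \<in> restrict_space lborel (ball 0 1 - {0}) \<rightarrow>\<^sub>M restrict_space borel S2"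
    by (intro measurable_restrict_space2 measurable_restrict_space1)
       (auto simp: space_restrict_space norm_sgn)
  have D: "D \<in> sets (restrict_space borel S2)"
    using assms by (simp add: sets_restrict_space_iff)
  have eq: "sgn -` D \<inter> space (restrict_space lborel (ball 0 1 - {0}))
      = {x. 0 < norm x \<and> norm x < 1 \<and> x /\<^sub>R norm x \<in> D}"
    by (auto simp: space_restrict_space sgn_div_norm)
  show ?thesis
    unfolding area_S2_def emeasure_scale_measure emeasure_distr[OF sgn D] eq
    by (subst emeasure_restrict_space) auto
qed

lemma emeasure_area_S2_sphere: "emeasure area_S2 S2 = ennreal (4 * pi)"
proof -
  have eq: "{x::real^3. 0 < norm x \<and> norm x < 1 \<and> x /\<^sub>R norm x \<in> S2} = ball 0 1 - {0}"
    by auto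
  have "emeasure lborel (ball 0 1 - {0} :: (real^3) set) = emeasure lborel (ball 0 1 :: (real^3) set)"
    by (intro emeasure_Diff_null_set) (auto simp: null_sets_def)
  also have "\<dots> = ennreal (4 / 3 * pi)"
    by (simp add: emeasure_ball eval_unit_ball_vol)
  finally show ?thesis
    unfolding emeasure_area_S2[OF borel_closed[OF closed_sphere] subset_refl] eq
    by (simp only: ennreal_numeral[symmetric], subst ennreal_mult[symmetric]) auto
qed

lemma cap_deviation_le:
  "\<bar>(\<Sum>j<n. indicator D (x j)) - real n * measure area_S2 D / (4 * pi)\<bar> \<le> real n"
proof -
  have "measure area_S2 D \<le> measure area_S2 S2"
  proof (cases "D \<in> sets area_S2")
    case True
    then show ?thesis
      using sets.sets_into_space[OF True] emeasure_area_S2_sphere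
      by (intro measure_mono_fmeasurable)
         (auto simp: space_area_S2 fmeasurable_def sets_area_S2 sets_restrict_space_iff)
  qed (simp add: measure_notin_sets)
  then have "measure area_S2 D / (4 * pi) \<le> 1"
    using emeasure_area_S2_sphere by (simp add: measure_def)
  then have 1: "real n * (measure area_S2 D / (4 * pi)) \<le> real n"
    by (intro mult_left_le) simp_all
  have 2: "0 \<le> real n * (measure area_S2 D / (4 * pi))"
    by simp
  have 3: "(\<Sum>j<n. indicator D (x j)) \<le> real n"
    using sum_bounded_above[of "{..<n}" "\<lambda>j. indicator D (x j) :: real" 1]
    by (simp add: indicator_le_1)
  have 4: "(0::real) \<le> (\<Sum>j<n. indicator D (x j))"
    by (simp add: sum_nonneg)
  show ?thesis
    using 1 2 3 4 unfolding times_divide_eq_right by linarith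
qed

end

theory Submission
  imports Defs "Jordan_Normal_Form.Determinant"
begin

text \<open>
  In spinor coordinates the joint density is the squared modulus of a Vandermonde determinant in
  the functions \<open>\<phi>\<^sub>k = a ^ (n - 1 - k) * b ^ k\<close>, which stay orthogonal after multiplication by
  any function of the height. Expanding the determinant therefore gives, for the number \<open>N\<close> of
  points in a cap of relative area \<open>s\<close>,
  \<open>E (exp (t N)) = (\<Prod>k<n. 1 + (exp t - 1) p\<^sub>k)\<close>, where by the theorem of Archimedes
  \<open>p\<^sub>k\<close> is an incomplete beta integral, that is, the probability that a binomial \<open>(n, s)\<close>
  variable exceeds \<open>k\<close>. So \<open>N\<close> behaves like a sum of independent Bernoulli variables with
  mean \<open>n s\<close> and variance \<open>(\<Sum>k<n. p\<^sub>k (1 - p\<^sub>k)) \<le> sqrt n\<close>. Chernoff's bound gives deviations of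
  order \<open>n powr (1/4) * sqrt (ln n)\<close> with polynomially small failure probability, and a union bound
  over a net of \<open>O(n ^ 4)\<close> caps, between which all others can be sandwiched at the cost of
  one point, covers all caps.
\<close>

section \<open>The homogeneous Vandermonde determinant\<close>

text \<open>The exponent 1/4 is a variance effect. For independent points the cap count has variance
  of order \<open>n\<close>, which would only allow deviations of order \<open>sqrt n\<close> up to
  logarithms. Here the parameters \<open>p\<^sub>k\<close> are binomial tails, close to 1 for
  \<open>k\<close> well below \<open>n s\<close> and close to 0 well above, so only about
  \<open>sqrt n\<close> indices near \<open>n s\<close> contribute variance.

  The generating function factorises only for weights that are invariant under rotations about the
  axis of the coordinates. As the density depends on distances alone and area is rotation invariant,
  every single cap can be turned to the pole. Caps with different axes cannot be treated jointly,
  which is why the supremum is reached through a union bound.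

  The constant in the density is never computed: the value \<open>t = 0\<close> determines it.
  Homogeneous coordinates make the centre of projection an ordinary point.

  The supremum runs over uncountably many caps, so the event needs its own measurability argument
  before probabilities can be complemented.\<close>

no_notation Matrix.vec_index (infixl "$" 100)
no_notation Matrix.scalar_prod (infix "\<bullet>" 70)

text \<open>Coefficients of the homogeneous Newton polynomial that vanishes at the first
  \<open>k\<close> projective points \<open>(a l : b l)\<close>. One recursion step multiplies by
  one more linear factor.\<close>

fun newton_coeff :: "(nat \<Rightarrow> 'a::comm_ring_1) \<Rightarrow> (nat \<Rightarrow> 'a) \<Rightarrow> nat \<Rightarrow> nat \<Rightarrow> 'a" where
  "newton_coeff a b 0 j = (if j = 0 then 1 else 0)"
| "newton_coeff a b (Suc k) j =
     a k * (if j = 0 then 0 else newton_coeff a b k (j - 1)) - b k * newton_coeff a b k j"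

lemma newton_coeff_eq_0: "k < j \<Longrightarrow> newton_coeff a b k j = 0"
  by (induction k arbitrary: j) auto

lemma newton_coeff_diag: "newton_coeff a b k k = (\<Prod>l<k. a l)"
  by (induction k) (simp_all add: newton_coeff_eq_0 mult.commute)

lemma newton_expansion:
  "(\<Prod>l<k. a l * y - x * b l) = (\<Sum>j\<le>k. newton_coeff a b k j * (x ^ (k - j) * y ^ j))"
proof (induction k)
  case 0
  then show ?case by simp
next
  case (Suc k)
  let ?c = "newton_coeff a b k"
  have "(\<Sum>j\<le>Suc k. newton_coeff a b (Suc k) j * (x ^ (Suc k - j) * y ^ j)) =
    (\<Sum>j\<le>Suc k. a k * (if j = 0 then 0 else ?c (j - 1)) * (x ^ (Suc k - j) * y ^ j))
     - (\<Sum>j\<le>Suc k. b k * ?c j * (x ^ (Suc k - j) * y ^ j))"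
    by (simp only: newton_coeff.simps left_diff_distrib sum_subtractf)
  also have "(\<Sum>j\<le>Suc k. a k * (if j = 0 then 0 else ?c (j - 1)) * (x ^ (Suc k - j) * y ^ j))
     = (\<Sum>j\<le>k. a k * ?c j * (x ^ (k - j) * y ^ Suc j))"
    by (subst sum.atMost_Suc_shift) simp
  also have "\<dots> = a k * y * (\<Sum>j\<le>k. ?c j * (x ^ (k - j) * y ^ j))"
    by (simp add: sum_distrib_left mult_ac)
  also have "(\<Sum>j\<le>Suc k. b k * ?c j * (x ^ (Suc k - j) * y ^ j))
     = (\<Sum>j\<le>k. b k * ?c j * (x ^ (Suc k - j) * y ^ j))"
    by (simp add: newton_coeff_eq_0)
  also have "\<dots> = x * b k * (\<Sum>j\<le>k. ?c j * (x ^ (k - j) * y ^ j))"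
    by (simp add: sum_distrib_left mult_ac Suc_diff_le)
  finally show ?case
    unfolding prod.lessThan_Suc Suc.IH by (simp only: left_diff_distrib right_diff_distrib mult_ac)
qed

text \<open>Homogenised so that a point at infinity, \<open>a i = 0\<close>, is a row like any
  other; \<open>a i = 1\<close> for all \<open>i\<close> gives the classical matrix.\<close>

definition vandermonde_hom :: "nat \<Rightarrow> (nat \<Rightarrow> 'a::comm_ring_1) \<Rightarrow> (nat \<Rightarrow> 'a) \<Rightarrow> 'a mat" where
  "vandermonde_hom n a b = mat n n (\<lambda>(i, k). a i ^ (n - 1 - k) * b i ^ k)"

lemma prod_prod_triangle:
  fixes a :: "nat \<Rightarrow> 'a::comm_monoid_mult"
  shows "(\<Prod>k<n. \<Prod>l<k. a l) = (\<Prod>l<n. a l ^ (n - 1 - l))"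
proof (induction n)
  case (Suc n)
  have "(\<Prod>l<n. a l ^ (n - l)) = (\<Prod>l<n. a l ^ (n - 1 - l) * a l)"
  proof (rule prod.cong)
    fix l assume "l \<in> {..<n}"
    then have "n - l = Suc (n - 1 - l)" by auto
    then show "a l ^ (n - l) = a l ^ (n - 1 - l) * a l"
      by (simp add: mult.commute)
  qed simp
  then show ?case by (simp add: Suc prod.distrib)
qed simp

text \<open>The upper triangular \<open>U\<close> replaces monomial columns by Newton columns.
  Column \<open>k\<close> of \<open>N\<close> then vanishes at the rows before \<open>k\<close>, so
  \<open>N\<close> is lower triangular and both determinants are products of diagonal entries. The
  powers of \<open>a l\<close> on the two sides agree, and \<open>nz\<close> allows them to be
  cancelled.\<close>

lemma det_vandermonde_hom_nonzero:
  fixes a b :: "nat \<Rightarrow> 'a::idom"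
  assumes nz: "\<And>i. i < n \<Longrightarrow> a i \<noteq> 0"
  shows "det (vandermonde_hom n a b) = (\<Prod>j<n. \<Prod>i<j. a i * b j - a j * b i)"
proof -
  define U where "U = mat n n (\<lambda>(j, k). newton_coeff a b k j)"
  define N where "N = mat n n (\<lambda>(i, k). a i ^ (n - 1 - k) * (\<Prod>l<k. a l * b i - a i * b l))"
  let ?V = "vandermonde_hom n a b"
  have VU: "?V \<in> carrier_mat n n" "U \<in> carrier_mat n n" and N: "N \<in> carrier_mat n n"
    by (auto simp: vandermonde_hom_def U_def N_def)
  have "N = ?V * U"
  proof (rule eq_matI)
    fix i k assume "i < dim_row (?V * U)" "k < dim_col (?V * U)"
    then have i: "i < n" and k: "k < n" by (auto simp: vandermonde_hom_def U_def)
    have "N $$ (i, k) = (\<Sum>j\<le>k. a i ^ (n - 1 - k) * (newton_coeff a b k j * (a i ^ (k - j) * b i ^ j)))"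
      using i k by (simp add: N_def newton_expansion sum_distrib_left)
    also have "\<dots> = (\<Sum>j\<le>k. a i ^ (n - 1 - j) * b i ^ j * newton_coeff a b k j)"
    proof (rule sum.cong)
      fix j assume "j \<in> {..k}"
      then have "n - 1 - j = (n - 1 - k) + (k - j)" using k by auto
      then have e: "a i ^ (n - 1 - j) = a i ^ (n - 1 - k) * a i ^ (k - j)"
        by (simp only: power_add)
      show "a i ^ (n - 1 - k) * (newton_coeff a b k j * (a i ^ (k - j) * b i ^ j)) =
          a i ^ (n - 1 - j) * b i ^ j * newton_coeff a b k j"
        unfolding e by (simp add: mult_ac)
    qed simp
    also have "\<dots> = (\<Sum>j<n. a i ^ (n - 1 - j) * b i ^ j * newton_coeff a b k j)"
      using k by (intro sum.mono_neutral_left) (auto simp: newton_coeff_eq_0)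
    finally show "N $$ (i, k) = (?V * U) $$ (i, k)"
      using i k by (simp add: vandermonde_hom_def U_def scalar_prod_def lessThan_atLeast0)
  qed (auto simp: N_def vandermonde_hom_def U_def)
  then have "det N = det ?V * det U"
    using det_mult[OF VU] by simp
  moreover have "det U = (\<Prod>k<n. \<Prod>l<k. a l)"
    using det_upper_triangular[OF _ VU(2)]
    by (simp add: U_def upper_triangular_def newton_coeff_eq_0 newton_coeff_diag
        prod_list_diag_prod lessThan_atLeast0)
  moreover have "det N = (\<Prod>k<n. a k ^ (n - 1 - k) * (\<Prod>l<k. a l * b k - a k * b l))"
  proof -
    have "N $$ (i, j) = 0" if "i < j" "j < n" for i j
      using that by (auto simp: N_def mult.commute intro!: prod_zero bexI[of _ i])
    then have "det N = prod_list (diag_mat N)"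
      by (intro det_lower_triangular[OF _ N])
    also have "\<dots> = (\<Prod>k<n. a k ^ (n - 1 - k) * (\<Prod>l<k. a l * b k - a k * b l))"
      by (simp add: N_def prod_list_diag_prod lessThan_atLeast0)
    finally show ?thesis .
  qed
  ultimately have "det ?V * (\<Prod>l<n. a l ^ (n - 1 - l)) =
      (\<Prod>j<n. \<Prod>i<j. a i * b j - a j * b i) * (\<Prod>l<n. a l ^ (n - 1 - l))"
    by (simp only: prod_prod_triangle prod.distrib mult.commute)
  moreover have "(\<Prod>l<n. a l ^ (n - 1 - l)) \<noteq> 0"
    using nz by simp
  ultimately show ?thesis
    by (rule mult_right_cancel[THEN iffD1, rotated])
qed

text \<open>The case of vanishing entries follows by perturbing \<open>a i\<close> to \<open>a i + X\<close> in the
  polynomial ring and evaluating at \<open>0\<close>.\<close>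
theorem det_vandermonde_hom:
  fixes a b :: "nat \<Rightarrow> 'a::idom"
  shows "det (vandermonde_hom n a b) = (\<Prod>j<n. \<Prod>i<j. a i * b j - a j * b i)"
proof -
  let ?A = "\<lambda>i. [:a i, 1:]" and ?B = "\<lambda>i. [:b i:]"
  have "poly (det (vandermonde_hom n ?A ?B)) 0 = det (vandermonde_hom n a b)"
    by (simp add: Determinant.det_def vandermonde_hom_def poly_sum poly_prod of_int_poly sign_def)
  moreover have "det (vandermonde_hom n ?A ?B) = (\<Prod>j<n. \<Prod>i<j. ?A i * ?B j - ?A j * ?B i)"
    by (rule det_vandermonde_hom_nonzero) simp
  ultimately show ?thesis
    by (simp add: poly_prod mult.commute)
qed

corollary vandermonde_hom_expansion:
  fixes a b :: "nat \<Rightarrow> 'a::idom"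
  shows "(\<Prod>j<n. \<Prod>i<j. a i * b j - a j * b i) =
    (\<Sum>\<sigma> | \<sigma> permutes {..<n}. of_int (sign \<sigma>) * (\<Prod>i<n. a i ^ (n - 1 - \<sigma> i) * b i ^ \<sigma> i))"
proof -
  have *: "\<sigma> i < n" if "\<sigma> permutes {..<n}" "i < n" for \<sigma> i
    using permutes_in_image[OF that(1), of i] that(2) by simp
  let ?V = "vandermonde_hom n a b"
  have "det ?V = (\<Sum>\<sigma> | \<sigma> permutes {..<n}. of_int (sign \<sigma>) * (\<Prod>i<n. ?V $$ (i, \<sigma> i)))"
    by (simp add: Determinant.det_def vandermonde_hom_def lessThan_atLeast0)
  also have "\<dots> = (\<Sum>\<sigma> | \<sigma> permutes {..<n}.
      of_int (sign \<sigma>) * (\<Prod>i<n. a i ^ (n - 1 - \<sigma> i) * b i ^ \<sigma> i))"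
    by (intro sum.cong refl arg_cong2[of _ _ _ _ times] prod.cong)
       (auto simp: vandermonde_hom_def *)
  finally show ?thesis
    by (simp only: det_vandermonde_hom)
qed

section \<open>Gram determinants of orthogonal functions\<close>

text \<open>Two different permutations disagree at some index below \<open>n\<close>, where an
  off-diagonal factor kills the term. For \<open>\<tau> = \<sigma>\<close> the signs square to 1 and
  reindexing by \<open>\<sigma>\<close> removes the dependence on \<open>\<sigma>\<close>, leaving
  \<open>fact n\<close> equal terms.\<close>

lemma sum_double_permutes_diag:
  fixes c :: "nat \<Rightarrow> nat \<Rightarrow> 'a::{comm_ring_1,semiring_char_0}"
  assumes diag: "\<And>k l. k < n \<Longrightarrow> l < n \<Longrightarrow> k \<noteq> l \<Longrightarrow> c k l = 0"
  shows "(\<Sum>\<sigma> | \<sigma> permutes {..<n}. \<Sum>\<tau> | \<tau> permutes {..<n}.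
            of_int (sign \<sigma>) * of_int (sign \<tau>) * (\<Prod>i<n. c (\<sigma> i) (\<tau> i)))
         = fact n * (\<Prod>k<n. c k k)"
proof -
  let ?P = "{\<sigma>. \<sigma> permutes {..<n}}"
  have fin: "finite ?P" by (simp add: finite_permutations)
  have "(\<Sum>\<tau>\<in>?P. of_int (sign \<sigma>) * of_int (sign \<tau>) * (\<Prod>i<n. c (\<sigma> i) (\<tau> i)))
      = (\<Prod>k<n. c k k)" if \<sigma>: "\<sigma> \<in> ?P" for \<sigma>
  proof -
    have lt: "\<rho> i < n" if "\<rho> \<in> ?P" "i < n" for \<rho> i
      using permutes_in_image[of \<rho> "{..<n}" i] that by simp
    have "(\<Sum>\<tau>\<in>?P. of_int (sign \<sigma>) * of_int (sign \<tau>) * (\<Prod>i<n. c (\<sigma> i) (\<tau> i)))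
        = (\<Sum>\<tau>\<in>{\<sigma>}. of_int (sign \<sigma>) * of_int (sign \<tau>) * (\<Prod>i<n. c (\<sigma> i) (\<tau> i)))"
    proof (rule sum.mono_neutral_right)
      show "\<forall>\<tau>\<in>?P - {\<sigma>}. of_int (sign \<sigma>) * of_int (sign \<tau>) * (\<Prod>i<n. c (\<sigma> i) (\<tau> i)) = 0"
      proof
        fix \<tau> assume \<tau>: "\<tau> \<in> ?P - {\<sigma>}"
        then obtain i where i: "\<tau> i \<noteq> \<sigma> i" by auto
        have "i < n"
        proof (rule ccontr)
          assume "\<not> i < n"
          then have "\<tau> i = i" "\<sigma> i = i"
            using \<sigma> \<tau> permutes_not_in[of _ "{..<n}" i] by auto
          with i show False by simp
        qed
        then have "c (\<sigma> i) (\<tau> i) = 0"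
          using \<sigma> \<tau> i lt[of \<sigma> i] lt[of \<tau> i] by (intro diag) auto
        with \<open>i < n\<close> have "(\<Prod>i<n. c (\<sigma> i) (\<tau> i)) = 0"
          by (intro prod_zero) auto
        then show "of_int (sign \<sigma>) * of_int (sign \<tau>) * (\<Prod>i<n. c (\<sigma> i) (\<tau> i)) = 0" by simp
      qed
    qed (use \<sigma> fin in auto)
    also have "\<dots> = (\<Prod>i<n. c (\<sigma> i) (\<sigma> i))"
      by (simp add: sign_def)
    also have "\<dots> = (\<Prod>k<n. c k k)"
      using prod.permute[of \<sigma> "{..<n}" "\<lambda>k. c k k"] \<sigma> by (simp add: o_def)
    finally show ?thesis .
  qed
  then have "(\<Sum>\<sigma>\<in>?P. \<Sum>\<tau>\<in>?P. of_int (sign \<sigma>) * of_int (sign \<tau>) * (\<Prod>i<n. c (\<sigma> i) (\<tau> i)))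
      = of_nat (card ?P) * (\<Prod>k<n. c k k)"
    by simp
  then show ?thesis
    by (simp add: card_permutations)
qed

text \<open>The orthogonal case of Andreief's identity. The squared modulus is expanded as a double
  sum over permutations, and Fubini turns each term into a product of one-variable inner
  products.\<close>

lemma integral_norm_det_orthogonal:
  fixes \<phi> :: "nat \<Rightarrow> 'a \<Rightarrow> complex"
  assumes "sigma_finite_measure M"
    and int: "\<And>k l. k < n \<Longrightarrow> l < n \<Longrightarrow> integrable M (\<lambda>x. \<phi> k x * cnj (\<phi> l x))"
    and orth: "\<And>k l. k < n \<Longrightarrow> l < n \<Longrightarrow> k \<noteq> l \<Longrightarrow> (\<integral>x. \<phi> k x * cnj (\<phi> l x) \<partial>M) = 0"
  defines "D \<equiv> \<lambda>p. \<Sum>\<sigma> | \<sigma> permutes {..<n}. of_int (sign \<sigma>) * (\<Prod>i<n. \<phi> (\<sigma> i) (p i))"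
  shows "integrable (\<Pi>\<^sub>M i\<in>{..<n}. M) (\<lambda>p. (cmod (D p))\<^sup>2)"
    and "(\<integral>p. (cmod (D p))\<^sup>2 \<partial>(\<Pi>\<^sub>M i\<in>{..<n}. M)) = fact n * (\<Prod>k<n. \<integral>x. (cmod (\<phi> k x))\<^sup>2 \<partial>M)"
proof -
  interpret sigma_finite_measure M by fact
  interpret product_sigma_finite "\<lambda>_. M" ..
  let ?M = "\<Pi>\<^sub>M i\<in>{..<n}. M"
  let ?P = "{\<sigma>. \<sigma> permutes {..<n}}"
  let ?t = "\<lambda>\<sigma> \<tau> p. of_int (sign \<sigma>) * of_int (sign \<tau>) * (\<Prod>i<n. \<phi> (\<sigma> i) (p i) * cnj (\<phi> (\<tau> i) (p i)))"
  let ?c = "\<lambda>k l. \<integral>x. \<phi> k x * cnj (\<phi> l x) \<partial>M"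
  have lt: "\<rho> i < n" if "\<rho> \<in> ?P" "i < n" for \<rho> i
    using permutes_in_image[of \<rho> "{..<n}" i] that by simp
  have expand: "complex_of_real ((cmod (D p))\<^sup>2) = (\<Sum>\<sigma>\<in>?P. \<Sum>\<tau>\<in>?P. ?t \<sigma> \<tau> p)" for p
    unfolding D_def complex_norm_square
    by (simp add: sum_product prod.distrib mult_ac)
  have int_t: "integrable ?M (?t \<sigma> \<tau>)" if "\<sigma> \<in> ?P" "\<tau> \<in> ?P" for \<sigma> \<tau>
    using that lt[of \<sigma>] lt[of \<tau>] by (intro integrable_mult_right product_integrable_prod int) auto
  have integral_t: "(\<integral>p. ?t \<sigma> \<tau> p \<partial>?M) = of_int (sign \<sigma>) * of_int (sign \<tau>) * (\<Prod>i<n. ?c (\<sigma> i) (\<tau> i))"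
    if "\<sigma> \<in> ?P" "\<tau> \<in> ?P" for \<sigma> \<tau>
    using that lt[of \<sigma>] lt[of \<tau>] by (simp, subst product_integral_prod) (auto intro!: int)
  have "integrable ?M (\<lambda>p. complex_of_real ((cmod (D p))\<^sup>2))"
    unfolding expand using int_t by (intro Bochner_Integration.integrable_sum) auto
  then show "integrable ?M (\<lambda>p. (cmod (D p))\<^sup>2)"
    by (simp only: complex_of_real_integrable_eq)
  have diag: "?c k k = complex_of_real (\<integral>x. (cmod (\<phi> k x))\<^sup>2 \<partial>M)" for k
    unfolding integral_complex_of_real[symmetric] complex_norm_square ..
  have "complex_of_real (\<integral>p. (cmod (D p))\<^sup>2 \<partial>?M) = (\<integral>p. (\<Sum>\<sigma>\<in>?P. \<Sum>\<tau>\<in>?P. ?t \<sigma> \<tau> p) \<partial>?M)"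
    unfolding integral_complex_of_real[symmetric] expand ..
  also have "\<dots> = (\<Sum>\<sigma>\<in>?P. \<integral>p. (\<Sum>\<tau>\<in>?P. ?t \<sigma> \<tau> p) \<partial>?M)"
    using int_t by (intro Bochner_Integration.integral_sum Bochner_Integration.integrable_sum) auto
  also have "\<dots> = (\<Sum>\<sigma>\<in>?P. \<Sum>\<tau>\<in>?P. \<integral>p. ?t \<sigma> \<tau> p \<partial>?M)"
    using int_t by (intro sum.cong refl Bochner_Integration.integral_sum) auto
  also have "\<dots> = (\<Sum>\<sigma>\<in>?P. \<Sum>\<tau>\<in>?P. of_int (sign \<sigma>) * of_int (sign \<tau>) * (\<Prod>i<n. ?c (\<sigma> i) (\<tau> i)))"
    by (intro sum.cong refl integral_t)
  also have "\<dots> = fact n * (\<Prod>k<n. ?c k k)"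
    using orth by (rule sum_double_permutes_diag)
  also have "\<dots> = complex_of_real (fact n * (\<Prod>k<n. \<integral>x. (cmod (\<phi> k x))\<^sup>2 \<partial>M))"
    by (simp add: diag)
  finally show "(\<integral>p. (cmod (D p))\<^sup>2 \<partial>?M) = fact n * (\<Prod>k<n. \<integral>x. (cmod (\<phi> k x))\<^sup>2 \<partial>M)"
    by (simp only: of_real_eq_iff)
qed

section \<open>Surface area on the sphere\<close>

text \<open>The preimage is the image under the inverse map, which is again orthogonal. Boundedness
  makes both measures finite, so equality of the real-valued \<open>measure\<close> is
  enough.\<close>

lemma emeasure_lborel_orthogonal_vimage:
  fixes f :: "real^'n::{finite,wellorder} \<Rightarrow> real^'n::_"
  assumes f: "orthogonal_transformation f" and A: "A \<in> sets borel" "bounded A"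
  shows "emeasure lborel (f -` A) = emeasure lborel A"
proof -
  have fin: "emeasure lborel B = ennreal (measure lebesgue B)" if "B \<in> lmeasurable" "B \<in> sets borel" for B :: "(real^'n::_) set"
    using emeasure_eq_measure2[OF that(1)] that(2) by simp
  let ?g = "inv_into UNIV f"
  have bij: "bij f" using f by (rule orthogonal_transformation_bij)
  have g: "orthogonal_transformation ?g" using f by (rule orthogonal_transformation_inv)
  have eq: "f -` A = ?g ` A" using bij by (rule bij_vimage_eq_inv_image)
  have A': "A \<in> lmeasurable"
    using A by (intro bounded_set_imp_lmeasurable) auto
  have "continuous_on UNIV f"
    using orthogonal_transformation_linear[OF f]
    by (intro linear_continuous_on) (simp add: linear_conv_bounded_linear)
  then have "f -` A \<in> sets borel"
    using A(1) by (metis borel_measurable_continuous_onI measurable_sets space_borel Int_UNIV_right)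
  then show ?thesis
    using measurable_orthogonal_image[OF g A'] measure_orthogonal_image[OF g A'] A A'
    by (simp add: fin eq)
qed

interpretation area_S2: finite_measure area_S2
  by standard (simp add: space_area_S2 emeasure_area_S2_sphere)

lemma measurable_area_S2_borel:
  assumes "f \<in> borel_measurable borel"
  shows "f \<in> borel_measurable area_S2"
  using measurable_restrict_space1[OF assms, of S2] by (simp only: measurable_cong_sets[OF sets_area_S2 refl])

text \<open>An orthogonal map preserves norms and commutes with scaling, so the cone over a preimage
  is the preimage of the cone. Invariance of area thus reduces to invariance of volume.\<close>

lemma distr_area_S2_orthogonal:
  assumes f: "orthogonal_transformation f"
  shows "f \<in> area_S2 \<rightarrow>\<^sub>M area_S2" "distr area_S2 area_S2 f = area_S2"
proof -
  have norm: "norm (f x) = norm x" for x using f by (rule orthogonal_transformation_norm)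
  have nz: "f x = 0 \<longleftrightarrow> x = 0" for x using norm[of x] by (metis norm_eq_zero)
  have lin: "linear f" using f by (rule orthogonal_transformation_linear)
  have "f \<in> borel_measurable borel"
    using lin by (intro borel_measurable_continuous_onI linear_continuous_on) (simp add: linear_conv_bounded_linear)
  then have f1: "f \<in> restrict_space borel S2 \<rightarrow>\<^sub>M borel"
    by (rule measurable_restrict_space1)
  have "f \<in> restrict_space borel S2 \<rightarrow>\<^sub>M restrict_space borel S2"
    by (rule measurable_restrict_space2[OF _ f1]) (simp add: space_restrict_space norm)
  then show meas: "f \<in> area_S2 \<rightarrow>\<^sub>M area_S2"
    by (simp only: measurable_cong_sets[OF sets_area_S2 sets_area_S2])
  show "distr area_S2 area_S2 f = area_S2"
  proof (rule measure_eqI)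
    fix D assume "D \<in> sets (distr area_S2 area_S2 f)"
    then have D: "D \<in> sets area_S2" by simp
    then have D': "D \<in> sets borel" "D \<subseteq> S2"
      by (auto simp: sets_area_S2 sets_restrict_space_iff)
    have fD: "f -` D \<inter> S2 \<in> sets area_S2"
      using measurable_sets[OF meas D] by (simp add: space_area_S2)
    then have fD': "f -` D \<inter> S2 \<in> sets borel"
      by (simp add: sets_area_S2 sets_restrict_space_iff)
    let ?C = "\<lambda>D. {x :: real^3. 0 < norm x \<and> norm x < 1 \<and> x /\<^sub>R norm x \<in> D}"
    have C: "?C D \<in> sets borel"
    proof -
      have "?C D = {x \<in> space borel. 0 < norm x \<and> norm x < 1 \<and> x /\<^sub>R norm x \<in> D}" by simp
      also have "\<dots> \<in> sets borel" using D'(1) by measurable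
      finally show ?thesis .
    qed
    have "emeasure (distr area_S2 area_S2 f) D = emeasure area_S2 (f -` D \<inter> S2)"
      by (simp add: emeasure_distr[OF meas D] space_area_S2)
    also have "\<dots> = 3 * emeasure lborel (?C (f -` D \<inter> S2))"
      by (rule emeasure_area_S2[OF fD']) simp
    also have "?C (f -` D \<inter> S2) = f -` (?C D)"
      by (auto simp: norm nz linear_scale[OF lin])
    also have "emeasure lborel \<dots> = emeasure lborel (?C D)"
      using f C by (rule emeasure_lborel_orthogonal_vimage) (auto simp: bounded_iff intro!: exI[of _ 1])
    also have "3 * emeasure lborel (?C D) = emeasure area_S2 D"
      by (rule emeasure_area_S2[OF D', symmetric])
    finally show "emeasure (distr area_S2 area_S2 f) D = emeasure area_S2 D" .
  qed simp
qed

section \<open>Volume of the cone over a polar cap\<close>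

lemma borel_measurable_vector3:
  "(\<lambda>p. vector [fst (fst p), snd (fst p), snd p] :: real^3) \<in> borel_measurable borel"
proof -
  have eq: "(\<lambda>p. vector [fst (fst p), snd (fst p), snd p] :: real^3) =
      (\<lambda>p. fst (fst p) *\<^sub>R axis 1 1 + snd (fst p) *\<^sub>R axis 2 1 + snd p *\<^sub>R axis 3 1)"
    by (rule ext) (auto simp: Finite_Cartesian_Product.vec_eq_iff forall_3 axis_def)
  show ?thesis
    unfolding eq by (intro borel_measurable_continuous_onI continuous_intros)
qed

text \<open>Gives access to Fubini: with the nesting \<open>((x, y), z)\<close> the sections at
  fixed third coordinate are sets in the plane.\<close>

lemma lborel_vec3: "distr lborel borel (\<lambda>p. vector [fst (fst p), snd (fst p), snd p] :: real^3) = lborel"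
proof (rule lborel_eqI[symmetric])
  let ?e = "\<lambda>p. vector [fst (fst p), snd (fst p), snd p] :: real^3"
  have e: "?e \<in> borel_measurable lborel"
    using borel_measurable_vector3 by (simp only: measurable_lborel2)
  fix l u :: "real^3" assume le: "\<And>b. b \<in> Basis \<Longrightarrow> l \<bullet> b \<le> u \<bullet> b"
  then have le': "l $ i \<le> u $ i" for i
    by (simp add: cart_eq_inner_axis)
  have [simp]: "box l u \<in> sets borel" by simp
  have eq: "?e -` box l u \<inter> space lborel = box ((l$1, l$2), l$3) ((u$1, u$2), u$3)"
  proof -
    have "p \<in> box ((a, b), c) ((a', b'), c') \<longleftrightarrow> a < fst (fst p) \<and> fst (fst p) < a' \<and>
        b < snd (fst p) \<and> snd (fst p) < b' \<and> c < snd p \<and> snd p < c'" for p and a b c a' b' c' :: real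
      by (cases p) (auto simp: box_def Basis_prod_def)
    then show ?thesis
      by (auto simp: mem_box_cart forall_3)
  qed
  have "(\<Prod>b\<in>Basis. (u - l) \<bullet> b) = (\<Prod>i\<in>UNIV. u $ i - l $ i)"
  proof -
    have B: "(Basis :: (real^3) set) = (\<lambda>i. axis i 1) ` UNIV" by (auto simp: Basis_vec_def)
    show ?thesis unfolding B
      by (subst prod.reindex) (auto simp: inj_on_def axis_eq_axis inner_axis)
  qed
  also have "\<dots> = (u$1 - l$1) * (u$2 - l$2) * (u$3 - l$3)"
    unfolding UNIV_3 by simp
  finally have R: "(\<Prod>b\<in>Basis. (u - l) \<bullet> b) = (u$1 - l$1) * (u$2 - l$2) * (u$3 - l$3)" .
  have "emeasure lborel (box ((l$1, l$2), l$3) ((u$1, u$2), u$3)) = ennreal ((u$1 - l$1) * (u$2 - l$2) * (u$3 - l$3))"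
    by (subst emeasure_lborel_box) (auto simp: le' Basis_prod_def prod.union_disjoint prod.reindex inj_on_def ennreal_mult'' mult_ac)
  then show "emeasure (distr lborel borel ?e) (box l u) = ennreal (\<Prod>b\<in>Basis. (u - l) \<bullet> b)"
    unfolding R by (subst emeasure_distr[OF e]) (simp_all only: eq sets_lborel borel_open open_box sets_distr)
qed simp

lemma sqrt_lt_iff_sq: "sqrt a < t \<longleftrightarrow> 0 < t \<and> a < t\<^sup>2" if "0 \<le> a" for a t :: real
  by (meson that dual_order.strict_trans2 linorder_not_less power2_le_imp_le real_sqrt_ge_zero real_sqrt_less_iff
      real_le_lsqrt real_less_lsqrt real_le_rsqrt less_imp_le)

text \<open>Cavalieri's principle. For \<open>s > 0\<close> every nonempty horizontal section is a
  disc; its squared radius is the smaller of \<open>1 - t\<^sup>2\<close>, from the ball, and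
  \<open>t\<^sup>2 * (1 - s\<^sup>2) / s\<^sup>2\<close>, from the cone. The two bounds cross at
  \<open>t = s\<close>, where the integral is split.\<close>

lemma emeasure_cone_cap:
  assumes s: "0 < s" "s < 1"
  shows "emeasure lborel {x::real^3. 0 < norm x \<and> norm x < 1 \<and> s < (x /\<^sub>R norm x) $ 3}
     = ennreal (2 * pi / 3 * (1 - s))" (is "emeasure lborel ?S = _")
proof -
  let ?e = "\<lambda>p. vector [fst (fst p), snd (fst p), snd p] :: real^3"
  note e = borel_measurable_vector3
  have S: "?S \<in> sets borel"
  proof -
    have "(\<lambda>x::real^3. (x /\<^sub>R norm x) $ 3) \<in> borel_measurable borel"
      by (simp add: cart_eq_inner_axis)
    then have "{x \<in> space borel. 0 < norm x \<and> norm x < 1 \<and> s < (x /\<^sub>R norm (x::real^3)) $ 3} \<in> sets borel"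
      by measurable
    then show ?thesis by simp
  qed
  let ?r = "\<lambda>t. min (1 - t\<^sup>2) (t\<^sup>2 * (1 - s\<^sup>2) / s\<^sup>2)"
  have slice: "(\<lambda>q. (q, t)) -` (?e -` ?S) = (if 0 < t \<and> t < 1 then ball 0 (sqrt (?r t)) else {})" for t
  proof -
    have key: "(x, y) \<in> (\<lambda>q. (q, t)) -` (?e -` ?S) \<longleftrightarrow> 0 < t \<and> t < 1 \<and> x\<^sup>2 + y\<^sup>2 < ?r t" for x y
    proof -
      let ?q = "x\<^sup>2 + y\<^sup>2"
      have q: "0 \<le> ?q" by simp
      have n: "norm (vector [x, y, t] :: real^3) = sqrt (?q + t\<^sup>2)"
        by (simp add: norm_vec_def L2_set_def sum_3)
      have "(x, y) \<in> (\<lambda>q. (q, t)) -` (?e -` ?S) \<longleftrightarrow>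
          0 < sqrt (?q + t\<^sup>2) \<and> sqrt (?q + t\<^sup>2) < 1 \<and> s < t / sqrt (?q + t\<^sup>2)"
        by (simp only: vimage_eq mem_Collect_eq fst_conv snd_conv n vector_scaleR_component vector_3
            real_scaleR_def divide_inverse_commute)
      also have "\<dots> \<longleftrightarrow> 0 < ?q + t\<^sup>2 \<and> ?q + t\<^sup>2 < 1 \<and> sqrt (s\<^sup>2 * (?q + t\<^sup>2)) < t"
        using s by (auto simp: pos_less_divide_eq real_sqrt_mult)
      also have "\<dots> \<longleftrightarrow> 0 < ?q + t\<^sup>2 \<and> ?q + t\<^sup>2 < 1 \<and> 0 < t \<and> s\<^sup>2 * (?q + t\<^sup>2) < t\<^sup>2"
        using s by (subst sqrt_lt_iff_sq) auto
      also have "\<dots> \<longleftrightarrow> 0 < t \<and> ?q + t\<^sup>2 < 1 \<and> s\<^sup>2 * (?q + t\<^sup>2) < t\<^sup>2"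
        using q by (auto intro: add_nonneg_pos)
      also have "s\<^sup>2 * (?q + t\<^sup>2) < t\<^sup>2 \<longleftrightarrow> ?q < t\<^sup>2 * (1 - s\<^sup>2) / s\<^sup>2"
        using s by (simp add: pos_less_divide_eq algebra_simps)
      also have "0 < t \<and> ?q + t\<^sup>2 < 1 \<and> ?q < t\<^sup>2 * (1 - s\<^sup>2) / s\<^sup>2 \<longleftrightarrow> 0 < t \<and> t < 1 \<and> ?q < ?r t"
      proof -
        have "t < 1" if "?q + t\<^sup>2 < 1"
        proof (rule power2_less_imp_less)
          show "t\<^sup>2 < 1\<^sup>2" using that q unfolding one_power2 by linarith
        qed simp
        then show ?thesis by auto
      qed
      finally show ?thesis .
    qed
    show ?thesis
    proof (rule Set.set_eqI)
      fix p :: "real \<times> real"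
      obtain x y where p: "p = (x, y)" by (cases p)
      show "p \<in> (\<lambda>q. (q, t)) -` (?e -` ?S) \<longleftrightarrow> p \<in> (if 0 < t \<and> t < 1 then ball 0 (sqrt (?r t)) else {})"
        unfolding p key by (auto simp: dist_norm norm_Pair)
    qed
  qed
  have slice_meas: "emeasure lborel ((\<lambda>q. (q, t)) -` (?e -` ?S)) =
      (if 0 < t \<and> t < 1 then ennreal (pi * ?r t) else 0)" for t
  proof (cases "0 < t \<and> t < 1")
    case True
    then have "t\<^sup>2 \<le> 1" "s\<^sup>2 \<le> 1" using s by (auto intro: power_le_one)
    then have r: "0 \<le> ?r t" by simp
    then have "emeasure lborel (ball (0 :: real \<times> real) (sqrt (?r t))) = ennreal (pi * ?r t)"
      by (subst emeasure_ball) (auto simp: eval_unit_ball_vol)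
    with True show ?thesis unfolding slice by simp
  qed (simp only: slice if_False emeasure_empty)
  have "emeasure lborel ?S = emeasure (distr lborel borel ?e) ?S"
    by (simp only: lborel_vec3)
  also have "\<dots> = emeasure lborel (?e -` ?S)"
    by (subst emeasure_distr[OF _ S]) (simp_all only: measurable_lborel2 e space_lborel space_borel Int_UNIV_right)
  also have "\<dots> = emeasure (lborel \<Otimes>\<^sub>M lborel) (?e -` ?S)"
    by (simp only: lborel_prod)
  also have "\<dots> = (\<integral>\<^sup>+t. emeasure lborel ((\<lambda>q. (q, t)) -` (?e -` ?S)) \<partial>lborel)"
  proof (rule lborel_pair.emeasure_pair_measure_alt2)
    show "?e -` ?S \<in> sets (lborel \<Otimes>\<^sub>M lborel)"
      using measurable_sets[OF e S] by (simp only: lborel_prod sets_lborel space_borel Int_UNIV_right)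
  qed
  also have "\<dots> = (\<integral>\<^sup>+t. ennreal (pi * (t\<^sup>2 * (1 - s\<^sup>2) / s\<^sup>2)) * indicator {0..s} t
      + ennreal (pi * (1 - t\<^sup>2)) * indicator {s..1} t \<partial>lborel)"
  proof (rule nn_integral_cong_AE)
    have mono: "t\<^sup>2 * (1 - s\<^sup>2) / s\<^sup>2 \<le> 1 - t\<^sup>2 \<longleftrightarrow> t\<^sup>2 \<le> s\<^sup>2" for t
    proof -
      have "t\<^sup>2 * (1 - s\<^sup>2) / s\<^sup>2 = t\<^sup>2 / s\<^sup>2 - t\<^sup>2"
        using s by (simp add: right_diff_distrib diff_divide_distrib)
      moreover have "t\<^sup>2 / s\<^sup>2 \<le> 1 \<longleftrightarrow> t\<^sup>2 \<le> s\<^sup>2"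
        using s by (simp add: pos_divide_le_eq)
      ultimately show ?thesis by linarith
    qed
    \<comment> \<open>At \<open>t = s\<close> both closed indicators are 1 and the pieces are
      counted twice. Discarding the null set of the three breakpoints leaves only open ranges to
      compare.\<close>
    have "AE t in lborel. t \<noteq> 0 \<and> t \<noteq> s \<and> t \<noteq> (1::real)"
      by (intro AE_conjI AE_lborel_singleton)
    then show "AE t in lborel. emeasure lborel ((\<lambda>q. (q, t)) -` (?e -` ?S)) =
       ennreal (pi * (t\<^sup>2 * (1 - s\<^sup>2) / s\<^sup>2)) * indicator {0..s} t
      + ennreal (pi * (1 - t\<^sup>2)) * indicator {s..1} t"
    proof eventually_elim
      case (elim t)
      consider "t < 0" | "0 < t" "t < s" | "s < t" "t < 1" | "1 < t"
        using elim by linarith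
      then show ?case
      proof cases
        case 2
        then have "?r t = t\<^sup>2 * (1 - s\<^sup>2) / s\<^sup>2"
          using mono[of t] by (simp add: power_mono)
        with 2 s show ?thesis unfolding slice_meas by (simp add: indicator_def)
      next
        case 3
        then have "s\<^sup>2 < t\<^sup>2"
          using s by (intro power_strict_mono) auto
        then have "?r t = 1 - t\<^sup>2"
          using mono[of t] by simp
        with 3 s show ?thesis unfolding slice_meas by (simp add: indicator_def)
      next
        case 1
        with s show ?thesis unfolding slice_meas by (simp add: indicator_def)
      next
        case 4
        with s show ?thesis unfolding slice_meas by (simp add: indicator_def)
      qed
    qed
  qed
  also have "\<dots> = (\<integral>\<^sup>+t. ennreal (pi * (t\<^sup>2 * (1 - s\<^sup>2) / s\<^sup>2)) * indicator {0..s} t \<partial>lborel)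
      + (\<integral>\<^sup>+t. ennreal (pi * (1 - t\<^sup>2)) * indicator {s..1} t \<partial>lborel)"
    by (rule nn_integral_add) auto
  also have "(\<integral>\<^sup>+t. ennreal (pi * (t\<^sup>2 * (1 - s\<^sup>2) / s\<^sup>2)) * indicator {0..s} t \<partial>lborel)
      = ennreal (pi * (s^3 / 3 * (1 - s\<^sup>2) / s\<^sup>2) - pi * (0^3 / 3 * (1 - s\<^sup>2) / s\<^sup>2))"
  proof (rule nn_integral_FTC_Icc)
    fix x assume "x \<in> {0..s}"
    have "s\<^sup>2 \<le> 1" using s by (auto intro: power_le_one)
    then show "0 \<le> pi * (x\<^sup>2 * (1 - s\<^sup>2) / s\<^sup>2)" by simp
    have "((\<lambda>t. pi * (t^3 / 3 * c)) has_real_derivative pi * (x\<^sup>2 * c)) (at x)" for c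
      by (auto intro!: derivative_eq_intros)
    from this[of "(1 - s\<^sup>2) / s\<^sup>2"]
    show "((\<lambda>t. pi * (t^3 / 3 * (1 - s\<^sup>2) / s\<^sup>2)) has_real_derivative pi * (x\<^sup>2 * (1 - s\<^sup>2) / s\<^sup>2)) (at x)"
      by (simp only: times_divide_eq_right)
  qed (use s in auto)
  also have "(\<integral>\<^sup>+t. ennreal (pi * (1 - t\<^sup>2)) * indicator {s..1} t \<partial>lborel)
      = ennreal (pi * (1 - 1^3 / 3) - pi * (s - s^3 / 3))"
  proof (rule nn_integral_FTC_Icc)
    fix x assume "x \<in> {s..1}"
    then have "x\<^sup>2 \<le> 1" using s by (auto intro: power_le_one)
    then show "0 \<le> pi * (1 - x\<^sup>2)" by simp
    show "((\<lambda>t. pi * (t - t^3 / 3)) has_real_derivative pi * (1 - x\<^sup>2)) (at x)"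
      by (auto intro!: derivative_eq_intros)
  qed (use s in auto)
  also have "ennreal (pi * (s^3 / 3 * (1 - s\<^sup>2) / s\<^sup>2) - pi * (0^3 / 3 * (1 - s\<^sup>2) / s\<^sup>2))
      + ennreal (pi * (1 - 1^3 / 3) - pi * (s - s^3 / 3)) = ennreal (2 * pi / 3 * (1 - s))"
  proof -
    have 1: "pi * (s^3 / 3 * (1 - s\<^sup>2) / s\<^sup>2) = pi * (s * (1 - s\<^sup>2) / 3)"
      using s by (simp add: power3_eq_cube power2_eq_square)
    have "s\<^sup>2 \<le> 1" using s by (auto intro: power_le_one)
    then have 2: "0 \<le> pi * (s * (1 - s\<^sup>2) / 3)" using s by simp
    have "s ^ 3 = s * s\<^sup>2" by (simp add: power3_eq_cube power2_eq_square)
    \<comment> \<open>The polynomial is three times \<open>(1 - 1^3 / 3) - (s - s^3 / 3)\<close>.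
      Its sign is needed because \<open>ennreal\<close> is additive only on nonnegative
      reals.\<close>
    moreover have "0 \<le> (s - 1)\<^sup>2 * (s + 2)" using s by simp
    moreover have "(s - 1)\<^sup>2 * (s + 2) = s ^ 3 - 3 * s + 2" by (simp add: power2_eq_square power3_eq_cube algebra_simps)
    ultimately have "0 \<le> pi * ((1 - 1^3 / 3) - (s - s^3 / 3))"
      by (intro mult_nonneg_nonneg) auto
    then have 3: "0 \<le> pi * (1 - 1^3 / 3) - pi * (s - s^3 / 3)" by (simp add: algebra_simps)
    show ?thesis
      unfolding 1 using 2 3 by (subst ennreal_plus[symmetric]) (auto simp: field_simps power2_eq_square power3_eq_cube)
  qed
  finally show ?thesis .
qed

section \<open>Areas of polar caps and Archimedes' theorem\<close>

lemma measurable_nth_area_S2 [measurable]: "(\<lambda>p. p $ i) \<in> borel_measurable area_S2"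
  by (rule measurable_area_S2_borel) (simp add: cart_eq_inner_axis)

lemma sets_area_S2_gt [measurable]: "{p \<in> S2. h < p $ i} \<in> sets area_S2"
proof -
  have "{p \<in> space area_S2. h < p $ i} \<in> sets area_S2" by measurable
  then show ?thesis by (simp add: space_area_S2)
qed

lemma sets_area_S2_lt [measurable]: "{p \<in> S2. p $ i < h} \<in> sets area_S2"
proof -
  have "{p \<in> space area_S2. p $ i < h} \<in> sets area_S2" by measurable
  then show ?thesis by (simp add: space_area_S2)
qed

lemma measure_area_S2_sphere: "measure area_S2 S2 = 4 * pi"
  by (simp add: measure_def emeasure_area_S2_sphere)

lemma measure_area_S2_gt_pos:
  assumes "0 < h" "h < 1"
  shows "measure area_S2 {p \<in> S2. h < p $ 3} = 2 * pi * (1 - h)"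
proof -
  have D: "{p :: real^3. p \<in> S2 \<and> h < p $ 3} \<in> sets borel"
    using sets_area_S2_gt[of h 3] by (simp add: sets_area_S2 sets_restrict_space_iff)
  have eq: "{x. 0 < norm x \<and> norm x < 1 \<and> x /\<^sub>R norm x \<in> {p \<in> S2. h < p $ 3}} =
      {x::real^3. 0 < norm x \<and> norm x < 1 \<and> h < (x /\<^sub>R norm x) $ 3}"
    by (intro Collect_cong conj_cong refl) auto
  have "emeasure area_S2 {p \<in> S2. h < p $ 3} = 3 * ennreal (2 * pi / 3 * (1 - h))"
    using assms by (subst emeasure_area_S2[OF D]) (auto simp only: eq emeasure_cone_cap)
  also have "\<dots> = ennreal (2 * pi * (1 - h))"
    using assms by (simp only: ennreal_numeral[symmetric], subst ennreal_mult[symmetric]) auto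
  finally show ?thesis using assms by (simp add: measure_def)
qed

lemma measure_area_S2_lt: "measure area_S2 {p \<in> S2. p $ 3 < h} = measure area_S2 {p \<in> S2. - h < p $ 3}"
proof -
  have o: "orthogonal_transformation (uminus :: real^3 \<Rightarrow> real^3)"
    by (auto simp: orthogonal_transformation_def intro!: linearI)
  have "measure area_S2 {p \<in> S2. p $ 3 < h} = measure (distr area_S2 area_S2 uminus) {p \<in> S2. p $ 3 < h}"
    by (simp only: distr_area_S2_orthogonal(2)[OF o])
  also have "\<dots> = measure area_S2 (uminus -` {p \<in> S2. p $ 3 < h} \<inter> space area_S2)"
    by (intro measure_distr distr_area_S2_orthogonal(1)[OF o] sets_area_S2_lt)
  also have "uminus -` {p \<in> S2. p $ 3 < h} \<inter> space area_S2 = {p \<in> S2. - h < p $ 3}"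
    by (auto simp: space_area_S2)
  finally show ?thesis .
qed

lemma nth_le_1_S2: "p \<in> S2 \<Longrightarrow> \<bar>p $ i\<bar> \<le> 1"
  using component_le_norm_cart[of p i] by simp

text \<open>Nonpositive heights are reached from positive ones through the antipodal map. The circle
  \<open>p $ 3 = h\<close> has not been shown to be null, so complements give only inequalities:
  disjointness yields \<open>sum_le\<close>, overlap with a slightly larger \<open>h'\<close> yields
  \<open>sum_ge\<close>. Limits from the right close the gap.\<close>

lemma measure_area_S2_gt:
  "measure area_S2 {p \<in> S2. h < p $ 3} = 4 * pi * (1 - min 1 (max 0 ((1 + h) / 2)))"
proof -
  define G where "G h = measure area_S2 {p \<in> S2. h < p $ 3}" for h
  have mono: "G h' \<le> G h" if "h \<le> h'" for h h'
    unfolding G_def using that by (intro area_S2.finite_measure_mono sets_area_S2_gt) auto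
  have sum_le: "G h + G (- h) \<le> 4 * pi" for h
  proof -
    have "measure area_S2 {p \<in> S2. h < p $ 3} + measure area_S2 {p \<in> S2. p $ 3 < h}
        = measure area_S2 ({p \<in> S2. h < p $ 3} \<union> {p \<in> S2. p $ 3 < h})"
      by (intro area_S2.finite_measure_Union[symmetric] sets_area_S2_lt sets_area_S2_gt) auto
    also have "\<dots> \<le> measure area_S2 S2"
      using sets.top[of area_S2] by (intro area_S2.finite_measure_mono) (auto simp: space_area_S2)
    finally show ?thesis
      by (simp only: measure_area_S2_lt G_def measure_area_S2_sphere)
  qed
  have sum_ge: "4 * pi \<le> G h + G (- h')" if "h < h'" for h h'
  proof -
    have "measure area_S2 S2 = measure area_S2 ({p \<in> S2. h < p $ 3} \<union> {p \<in> S2. p $ 3 < h'})"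
      using that by (intro arg_cong[where f = "measure area_S2"]) auto
    also have "\<dots> \<le> measure area_S2 {p \<in> S2. h < p $ 3} + measure area_S2 {p \<in> S2. p $ 3 < h'}"
      by (intro measure_Un_le sets_area_S2_lt sets_area_S2_gt)
    finally show ?thesis
      by (simp only: measure_area_S2_lt G_def measure_area_S2_sphere)
  qed
  have pos: "G h = 2 * pi * (1 - h)" if "0 < h" "h < 1" for h
    unfolding G_def using that by (rule measure_area_S2_gt_pos)
  have ge1: "G h = 0" if "1 \<le> h" for h
  proof -
    have "{p \<in> S2. h < p $ 3} = {}"
      using nth_le_1_S2[of _ 3] that by fastforce
    then show ?thesis unfolding G_def by (simp only: measure_empty)
  qed
  have nonneg: "G h = 2 * pi * (1 - h)" if "0 \<le> h" "h < 1" for h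
  proof (cases "h = 0")
    case True
    have "2 * pi * (1 - \<epsilon>) \<le> G 0" if "0 < \<epsilon>" "\<epsilon> < 1" for \<epsilon>
      using mono[of 0 \<epsilon>] pos[OF that] that by simp
    then have "2 * pi * (1 - 0) \<le> G 0"
      by (intro tendsto_upperbound[of "\<lambda>\<epsilon>. 2 * pi * (1 - \<epsilon>)" "2 * pi * (1 - 0)" "at_right 0"]
            tendsto_intros eventually_at_rightI[of 0 1]) auto
    with sum_le[of 0] show ?thesis by (simp add: True)
  qed (use that pos in auto)
  have le: "G h \<le> 4 * pi" for h
    using sum_le[of h] by (smt (verit) G_def measure_nonneg)
  have neg: "G h = 2 * pi * (1 - h)" if "-1 \<le> h" "h < 0" for h
  proof (rule antisym)
    show "G h \<le> 2 * pi * (1 - h)"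
    proof (cases "h = -1")
      case False
      with that sum_le[of h] nonneg[of "-h"] show ?thesis by (simp add: algebra_simps)
    qed (use le in simp)
    have "2 * pi * (1 - h') \<le> G h" if "h < h'" "h' < 0" for h'
      using sum_ge[OF that(1)] nonneg[of "-h'"] that \<open>-1 \<le> h\<close> by (simp add: algebra_simps)
    then show "2 * pi * (1 - h) \<le> G h"
      using that
      by (intro tendsto_upperbound[of "\<lambda>\<epsilon>. 2 * pi * (1 - \<epsilon>)" "2 * pi * (1 - h)" "at_right h"]
            tendsto_intros eventually_at_rightI[of h 0]) auto
  qed
  have lt: "G h = 4 * pi" if "h < -1" for h
    using le[of h] mono[of h "-1"] neg[of "-1"] that by simp
  consider "h < -1" | "-1 \<le> h" "h < 0" | "0 \<le> h" "h < 1" | "1 \<le> h" by linarith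
  then have "G h = 4 * pi * (1 - min 1 (max 0 ((1 + h) / 2)))"
    by cases (auto simp: lt neg nonneg ge1 min_def max_def field_simps)
  then show ?thesis by (simp only: G_def)
qed

text \<open>Archimedes' theorem, with the height rescaled to \<open>[0, 1]\<close> so that it equals
  the fraction of area below it. Measures on the line that are finite and equal on all upper
  half-lines coincide, so the areas of polar caps suffice.\<close>

theorem distr_area_S2_height:
  "distr area_S2 borel (\<lambda>p. (1 + p $ 3) / 2) = density lborel (\<lambda>x. ennreal (4 * pi) * indicator {0..1} x)"
  (is "?L = ?R")
proof (rule measure_eqI_lessThan)
  fix x :: real
  have "emeasure ?L {x<..} = emeasure area_S2 {p \<in> S2. 2 * x - 1 < p $ 3}"
    by (subst emeasure_distr) (auto simp: space_area_S2 field_simps intro!: arg_cong[where f = "emeasure area_S2"])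
  also have "\<dots> = ennreal (4 * pi * (1 - min 1 (max 0 x)))"
    unfolding area_S2.emeasure_eq_measure measure_area_S2_gt by simp
  finally have L: "emeasure ?L {x<..} = ennreal (4 * pi * (1 - min 1 (max 0 x)))" .
  have "emeasure ?R {x<..} = (\<integral>\<^sup>+t. ennreal (4 * pi) * indicator ({0..1} \<inter> {x<..}) t \<partial>lborel)"
    by (subst emeasure_density) (auto simp: indicator_inter_arith mult_ac intro!: nn_integral_cong)
  also have "\<dots> = ennreal (4 * pi) * emeasure lborel ({0..1} \<inter> {x<..})"
    by (rule nn_integral_cmult_indicator) simp
  also have "emeasure lborel ({0..1} \<inter> {x<..}) = ennreal (1 - min 1 (max 0 x))"
  proof -
    consider "x < 0" | "0 \<le> x" "x < 1" | "1 \<le> x" by linarith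
    then show ?thesis
    proof cases
      case 1
      then have "{0..1} \<inter> {x<..} = {0..1}" by auto
      with 1 show ?thesis by simp
    next
      case 2
      then have "{0..1} \<inter> {x<..} = {x<..1}" by auto
      with 2 show ?thesis by simp
    next
      case 3
      then have "{0..1} \<inter> {x<..} = {}" by auto
      with 3 show ?thesis by simp
    qed
  qed
  finally show "emeasure ?L {x<..} = emeasure ?R {x<..}"
    unfolding L by (simp add: ennreal_mult'[symmetric])
  show "emeasure ?L {x<..} < \<infinity>" unfolding L by simp
qed simp_all

corollary integral_area_S2_zonal:
  fixes g :: "real \<Rightarrow> real"
  assumes [measurable]: "g \<in> borel_measurable borel"
  shows "(\<integral>p. g ((1 + p $ 3) / 2) \<partial>area_S2) = 4 * pi * (\<integral>x. indicator {0..1} x * g x \<partial>lborel)"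
proof -
  have "(\<integral>p. g ((1 + p $ 3) / 2) \<partial>area_S2) = (\<integral>x. g x \<partial>distr area_S2 borel (\<lambda>p. (1 + p $ 3) / 2))"
    by (rule integral_distr[symmetric]) auto
  also have "distr area_S2 borel (\<lambda>p. (1 + p $ 3) / 2) = density lborel (\<lambda>x. ennreal (4 * pi * indicator {0..1} x))"
    unfolding distr_area_S2_height by (simp add: ennreal_mult' ennreal_indicator)
  also have "(\<integral>x. g x \<partial>\<dots>) = (\<integral>x. (4 * pi * indicator {0..1} x) * g x \<partial>lborel)"
    by (subst integral_density) auto
  finally show ?thesis by (simp add: mult.assoc)
qed

section \<open>Spinor coordinates\<close>

text \<open>In homogeneous coordinates on the Riemann sphere, stereographic projection from the north
  pole \<open>p $ 3 = 1\<close> is \<open>spinor_snd p / spinor_fst p\<close>. The value \<open>1\<close> at the pole makes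
  the pair a unit vector everywhere.\<close>
definition spinor_fst :: "real^3 \<Rightarrow> complex" where
  "spinor_fst p = of_real (sqrt ((1 - p $ 3) / 2))"

definition spinor_snd :: "real^3 \<Rightarrow> complex" where
  "spinor_snd p = (if p $ 3 = 1 then 1
     else (of_real (p $ 1) + \<i> * of_real (p $ 2)) / of_real (2 * sqrt ((1 - p $ 3) / 2)))"

lemma S2_coordinates: "p \<in> S2 \<longleftrightarrow> (p $ 1)\<^sup>2 + (p $ 2)\<^sup>2 + (p $ 3)\<^sup>2 = 1"
  by (simp add: norm_vec_def L2_set_def sum_3)

text \<open>Separates the pole, where \<open>spinor_snd\<close> is a convention, from the points
  where division by \<open>spinor_fst\<close> is legitimate. There the positive number
  \<open>a\<close> rationalises the formulas: no square root remains.\<close>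

lemma spinor_cases:
  assumes "p \<in> S2"
  obtains (pole) "p $ 1 = 0" "p $ 2 = 0" "p $ 3 = 1" "spinor_fst p = 0" "spinor_snd p = 1"
  | (finite) a where "0 < a" "p $ 3 = 1 - 2 * a\<^sup>2" "(p $ 1)\<^sup>2 + (p $ 2)\<^sup>2 = 4 * a\<^sup>2 * (1 - a\<^sup>2)"
      "spinor_fst p = of_real a" "spinor_snd p = of_real (p $ 1 / (2 * a)) + \<i> * of_real (p $ 2 / (2 * a))"
proof (cases "p $ 3 = 1")
  case True
  then have "(p $ 1)\<^sup>2 + (p $ 2)\<^sup>2 = 0" using assms unfolding S2_coordinates by simp
  then show ?thesis using True by (intro pole) (auto simp: spinor_fst_def spinor_snd_def sum_power2_eq_zero_iff)
next
  case False
  then have h: "p $ 3 < 1" using nth_le_1_S2[OF assms, of 3] by auto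
  define a where "a = sqrt ((1 - p $ 3) / 2)"
  have a: "0 < a" "a\<^sup>2 = (1 - p $ 3) / 2" using h by (simp_all add: a_def)
  show ?thesis
  proof (rule finite[OF a(1)])
    show h': "p $ 3 = 1 - 2 * a\<^sup>2"
    proof -
      have "x = 1 - 2 * y" if "y = (1 - x) / 2" for x y :: real using that by (simp add: field_simps)
      from this[OF a(2)] show ?thesis .
    qed
    have "(p $ 1)\<^sup>2 + (p $ 2)\<^sup>2 = 1 - (p $ 3)\<^sup>2" using assms unfolding S2_coordinates by simp
    then show "(p $ 1)\<^sup>2 + (p $ 2)\<^sup>2 = 4 * a\<^sup>2 * (1 - a\<^sup>2)"
      unfolding h' by (simp add: power2_eq_square algebra_simps)
    show "spinor_fst p = of_real a" by (simp add: spinor_fst_def a_def)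
    show "spinor_snd p = of_real (p $ 1 / (2 * a)) + \<i> * of_real (p $ 2 / (2 * a))"
      using False by (simp add: spinor_snd_def a_def[symmetric] add_divide_distrib)
  qed
qed

lemma cmod_coords_sq: "(cmod (of_real x + \<i> * of_real y))\<^sup>2 = x\<^sup>2 + y\<^sup>2"
  by (simp add: cmod_power2)

lemma norm_spinor_fst: "p \<in> S2 \<Longrightarrow> (cmod (spinor_fst p))\<^sup>2 = (1 - p $ 3) / 2"
  by (erule spinor_cases) simp_all

lemma norm_spinor_snd:
  assumes "p \<in> S2" shows "(cmod (spinor_snd p))\<^sup>2 = (1 + p $ 3) / 2"
  using assms
proof (cases rule: spinor_cases)
  case (finite a)
  have "(cmod (spinor_snd p))\<^sup>2 = ((p $ 1)\<^sup>2 + (p $ 2)\<^sup>2) / (2 * a)\<^sup>2"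
    unfolding finite(5) cmod_coords_sq by (simp add: power_divide add_divide_distrib)
  also have "\<dots> = 1 - a\<^sup>2" using finite by (simp add: finite(3) power2_eq_square)
  finally show ?thesis by (simp add: finite(2))
qed simp

lemma norm_diff_sq_S2:
  assumes "p \<in> S2" "q \<in> S2"
  shows "(norm (p - q))\<^sup>2 = 2 - 2 * (p $ 1 * q $ 1 + p $ 2 * q $ 2 + p $ 3 * q $ 3)"
proof -
  have "(norm (p - q))\<^sup>2 = (p $ 1 - q $ 1)\<^sup>2 + (p $ 2 - q $ 2)\<^sup>2 + (p $ 3 - q $ 3)\<^sup>2"
    by (simp add: norm_vec_def L2_set_def sum_3)
  also have "\<dots> = ((p $ 1)\<^sup>2 + (p $ 2)\<^sup>2 + (p $ 3)\<^sup>2) + ((q $ 1)\<^sup>2 + (q $ 2)\<^sup>2 + (q $ 3)\<^sup>2)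
      - 2 * (p $ 1 * q $ 1 + p $ 2 * q $ 2 + p $ 3 * q $ 3)"
    by (simp add: power2_diff)
  finally show ?thesis using assms unfolding S2_coordinates by simp
qed

text \<open>The chordal metric of the Riemann sphere is, up to the factor 2, the determinant of the
  two unit spinors. This converts the product of distances in the density into the product evaluated
  by \<open>det_vandermonde_hom\<close>, with one factor 4 per pair.\<close>

lemma chordal_distance_spinor:
  assumes p: "p \<in> S2" and q: "q \<in> S2"
  shows "(norm (p - q))\<^sup>2 = 4 * (cmod (spinor_fst p * spinor_snd q - spinor_fst q * spinor_snd p))\<^sup>2"
  using p
proof (cases rule: spinor_cases)
  case pole
  then show ?thesis
    using norm_spinor_fst[OF q] by (simp add: norm_diff_sq_S2[OF p q] norm_minus_commute)
next
  case P: (finite a)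
  from q show ?thesis
  proof (cases rule: spinor_cases)
    case pole
    then show ?thesis
      using norm_spinor_fst[OF p] by (simp add: norm_diff_sq_S2[OF p q])
  next
    case Q: (finite b)
    let ?u = "\<lambda>i. a * (q $ i / (2 * b)) - b * (p $ i / (2 * a))"
    have "spinor_fst p * spinor_snd q - spinor_fst q * spinor_snd p =
        of_real (?u 1) + \<i> * of_real (?u 2)"
      unfolding P Q by (simp add: algebra_simps)
    then have "4 * (cmod (spinor_fst p * spinor_snd q - spinor_fst q * spinor_snd p))\<^sup>2 =
        4 * ((?u 1)\<^sup>2 + (?u 2)\<^sup>2)"
      by (simp only: cmod_coords_sq)
    also have sq: "4 * (?u i)\<^sup>2 = (a / b)\<^sup>2 * (q $ i)\<^sup>2 + (b / a)\<^sup>2 * (p $ i)\<^sup>2 - 2 * (p $ i * q $ i)" for i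
      using P(1) Q(1) by (simp add: field_simps power2_eq_square)
    have "4 * ((?u 1)\<^sup>2 + (?u 2)\<^sup>2) = (a / b)\<^sup>2 * ((q $ 1)\<^sup>2 + (q $ 2)\<^sup>2)
        + (b / a)\<^sup>2 * ((p $ 1)\<^sup>2 + (p $ 2)\<^sup>2) - 2 * (p $ 1 * q $ 1 + p $ 2 * q $ 2)"
      using sq[of 1] sq[of 2] by (simp add: distrib_left)
    also have "\<dots> = 4 * a\<^sup>2 * (1 - b\<^sup>2) + 4 * b\<^sup>2 * (1 - a\<^sup>2) - 2 * (p $ 1 * q $ 1 + p $ 2 * q $ 2)"
    proof -
      have K: "(x / y)\<^sup>2 * (4 * y\<^sup>2 * (1 - y\<^sup>2)) = 4 * x\<^sup>2 * (1 - y\<^sup>2)" if "0 < y" for x y :: real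
        using that by (simp add: power_divide)
      show ?thesis unfolding P(3) Q(3) K[OF P(1)] K[OF Q(1)] ..
    qed
    also have "\<dots> = (norm (p - q))\<^sup>2"
      unfolding norm_diff_sq_S2[OF p q] P(2) Q(2) by (simp add: algebra_simps)
    finally show ?thesis ..
  qed
qed

text \<open>With \<open>z\<close> the stereographic coordinate this is \<open>z ^ k\<close> times
  \<open>spinor_fst p ^ m\<close> for \<open>k \<le> m\<close>, written without division so that the
  pole is included. The ensemble of size \<open>n\<close> uses \<open>m = n - 1\<close>.\<close>

definition sphere_monomial :: "nat \<Rightarrow> nat \<Rightarrow> real^3 \<Rightarrow> complex" where
  "sphere_monomial m k p = spinor_fst p ^ (m - k) * spinor_snd p ^ k"

lemma borel_measurable_cnj [measurable (raw)]:
  assumes "f \<in> borel_measurable M"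
  shows "(\<lambda>x. cnj (f x)) \<in> borel_measurable M"
proof -
  have "cnj \<in> borel_measurable borel"
    by (intro borel_measurable_continuous_onI continuous_intros)
  then show ?thesis using assms by measurable
qed

lemma borel_measurable_sphere_monomial [measurable]: "sphere_monomial m k \<in> borel_measurable area_S2"
  unfolding sphere_monomial_def spinor_fst_def spinor_snd_def by measurable

lemma norm_sphere_monomial:
  assumes "p \<in> S2"
  shows "(cmod (sphere_monomial m k p))\<^sup>2 = (1 - (1 + p $ 3) / 2) ^ (m - k) * ((1 + p $ 3) / 2) ^ k"
proof -
  have "(cmod (sphere_monomial m k p))\<^sup>2 = ((cmod (spinor_fst p))\<^sup>2) ^ (m - k) * ((cmod (spinor_snd p))\<^sup>2) ^ k"
    by (simp add: sphere_monomial_def norm_mult norm_power power_mult_distrib power_mult[symmetric] mult.commute)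
  then show ?thesis
    using assms by (simp add: norm_spinor_fst norm_spinor_snd field_simps)
qed

lemma norm_sphere_monomial_le_1:
  assumes "p \<in> S2"
  shows "cmod (sphere_monomial m k p) \<le> 1"
proof -
  have "\<bar>p $ 3\<bar> \<le> 1" using assms by (rule nth_le_1_S2)
  then have "(cmod (sphere_monomial m k p))\<^sup>2 \<le> 1 * 1"
    unfolding norm_sphere_monomial[OF assms]
    by (intro mult_mono power_le_one zero_le_power) auto
  then show ?thesis
    by (simp add: abs_square_le_1)
qed

lemma integrable_sphere_monomial:
  fixes w :: "real \<Rightarrow> real"
  assumes [measurable]: "w \<in> borel_measurable borel" and w: "\<And>x. \<bar>w x\<bar> \<le> B"
  shows "integrable area_S2 (\<lambda>p. of_real (w (p $ 3)) * (sphere_monomial m k p * cnj (sphere_monomial m l p)))"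
proof (rule area_S2.integrable_const_bound)
  show "AE p in area_S2. norm (of_real (w (p $ 3)) * (sphere_monomial m k p * cnj (sphere_monomial m l p))) \<le> B"
  proof (rule AE_I2)
    fix p assume "p \<in> space area_S2"
    then have p: "p \<in> S2" by (simp add: space_area_S2)
    have "norm (of_real (w (p $ 3)) * (sphere_monomial m k p * cnj (sphere_monomial m l p)))
        = \<bar>w (p $ 3)\<bar> * (cmod (sphere_monomial m k p) * cmod (sphere_monomial m l p))"
      by (simp add: norm_mult)
    also have "\<dots> \<le> \<bar>w (p $ 3)\<bar> * (1 * 1)"
      using p by (intro mult_left_mono mult_mono norm_sphere_monomial_le_1) auto
    also have "\<dots> \<le> B" using w by simp
    finally show "norm (of_real (w (p $ 3)) * (sphere_monomial m k p * cnj (sphere_monomial m l p))) \<le> B" .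
  qed
qed (use assms(1) in measurable)

text \<open>The rotation by the angle \<open>\<pi> / (k - l)\<close> about the polar axis changes the sign of
  the integrand.\<close>
lemma sphere_monomial_orthogonal:
  fixes w :: "real \<Rightarrow> real"
  assumes [measurable]: "w \<in> borel_measurable borel"
    and kl: "k \<le> m" "l \<le> m" "k \<noteq> l"
  shows "(\<integral>p. of_real (w (p $ 3)) * (sphere_monomial m k p * cnj (sphere_monomial m l p)) \<partial>area_S2) = 0"
proof -
  let ?F = "\<lambda>p. of_real (w (p $ 3)) * (sphere_monomial m k p * cnj (sphere_monomial m l p))"
  define t where "t = pi / (real k - real l)"
  define f :: "real^3 \<Rightarrow> real^3" where
    "f p = vector [cos t * p $ 1 - sin t * p $ 2, sin t * p $ 1 + cos t * p $ 2, p $ 3]" for p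
  have f_nth: "f p $ 1 = cos t * p $ 1 - sin t * p $ 2" "f p $ 2 = sin t * p $ 1 + cos t * p $ 2" "f p $ 3 = p $ 3" for p
    by (simp_all add: f_def)
  have f: "orthogonal_transformation f"
    unfolding orthogonal_transformation_def
  proof (intro conjI allI)
    show "linear f"
      by (rule linearI) (auto simp: Finite_Cartesian_Product.vec_eq_iff forall_3 f_nth algebra_simps)
    fix v u :: "real^3"
    have "f v \<bullet> f u = (cos t * cos t + sin t * sin t) * (v $ 1 * u $ 1 + v $ 2 * u $ 2) + v $ 3 * u $ 3"
      by (simp add: inner_vec_def sum_3 f_nth algebra_simps del: sin_cos_squared_add3)
    also have "cos t * cos t + sin t * sin t = 1" by simp
    finally show "f v \<bullet> f u = v \<bullet> u"
      by (simp add: inner_vec_def sum_3)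
  qed
  have F_f: "?F (f p) = - ?F p" if "p \<in> S2" for p
    using that
  proof (cases rule: spinor_cases)
    case pole
    \<comment> \<open>The conventional value 1 of \<open>spinor_snd\<close> at the pole does not
      turn with the rotation. Since \<open>k\<close> and \<open>l\<close> differ, one of the two
      monomials carries a positive power of \<open>spinor_fst\<close>, so both sides are 0.\<close>
    have "m - k \<noteq> 0 \<or> m - l \<noteq> 0" using kl by auto
    moreover have "spinor_fst (f p) = 0" using pole by (simp add: spinor_fst_def f_nth)
    ultimately show ?thesis using pole by (auto simp: sphere_monomial_def power_0_left)
  next
    case (finite a)
    then have ne: "p $ 3 \<noteq> 1" by simp
    have 1: "spinor_fst (f p) = spinor_fst p" by (simp add: spinor_fst_def f_nth)
    have 2: "spinor_snd (f p) = cis t * spinor_snd p"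
      using ne by (simp add: spinor_snd_def f_nth cis_conv_exp[symmetric] complex_eq_iff Re_divide_of_real Im_divide_of_real)
    have "cis t ^ k * cnj (cis t ^ l) = cis (t * (real k - real l))"
      by (simp add: Complex.DeMoivre cis_cnj cis_mult algebra_simps)
    also have "t * (real k - real l) = pi" using kl by (simp add: t_def)
    finally have 3: "cis t ^ k * cnj (cis t ^ l) = -1" by simp
    have "sphere_monomial m k (f p) * cnj (sphere_monomial m l (f p)) =
       (cis t ^ k * cnj (cis t ^ l)) * (sphere_monomial m k p * cnj (sphere_monomial m l p))"
      by (simp add: sphere_monomial_def 1 2 power_mult_distrib mult_ac)
    then show ?thesis unfolding 3 by (simp add: f_nth)
  qed
  have "(\<integral>p. ?F p \<partial>area_S2) = (\<integral>p. ?F p \<partial>distr area_S2 area_S2 f)"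
    by (simp only: distr_area_S2_orthogonal(2)[OF f])
  also have "\<dots> = (\<integral>p. ?F (f p) \<partial>area_S2)"
    by (rule integral_distr[OF distr_area_S2_orthogonal(1)[OF f]]) measurable
  also have "\<dots> = (\<integral>p. - ?F p \<partial>area_S2)"
    by (intro Bochner_Integration.integral_cong refl F_f) (simp only: space_area_S2)
  also have "\<dots> = - (\<integral>p. ?F p \<partial>area_S2)"
    by (rule Bochner_Integration.integral_minus)
  finally show ?thesis by (simp add: equal_neg_zero)
qed

lemma integral_norm_sphere_monomial:
  fixes w :: "real \<Rightarrow> real"
  assumes [measurable]: "w \<in> borel_measurable borel"
  shows "(\<integral>p. w (p $ 3) * (cmod (sphere_monomial m k p))\<^sup>2 \<partial>area_S2)
     = 4 * pi * (\<integral>x. indicator {0..1} x * (w (2 * x - 1) * ((1 - x) ^ (m - k) * x ^ k)) \<partial>lborel)"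
proof -
  have "(\<integral>p. w (p $ 3) * (cmod (sphere_monomial m k p))\<^sup>2 \<partial>area_S2) =
      (\<integral>p. (\<lambda>x. w (2 * x - 1) * ((1 - x) ^ (m - k) * x ^ k)) ((1 + p $ 3) / 2) \<partial>area_S2)"
    by (intro Bochner_Integration.integral_cong refl)
       (simp only: space_area_S2 norm_sphere_monomial, simp add: field_simps)
  also have "\<dots> = 4 * pi * (\<integral>x. indicator {0..1} x * (w (2 * x - 1) * ((1 - x) ^ (m - k) * x ^ k)) \<partial>lborel)"
    by (rule integral_area_S2_zonal) measurable
  finally show ?thesis .
qed

section \<open>Binomial tails\<close>

definition binomial_tail :: "nat \<Rightarrow> nat \<Rightarrow> real \<Rightarrow> real" where
  "binomial_tail n k s = (\<Sum>j=Suc k..n. Bernstein n j s)"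

text \<open>Each Bernstein polynomial has derivative \<open>u j - u (Suc j)\<close>, so the tail
  telescopes to \<open>u (Suc k)\<close>; the last term vanishes because
  \<open>n choose Suc n\<close> is 0. Up to a constant, the tail is therefore an antiderivative of
  the squared modulus of \<open>sphere_monomial (n - 1) k\<close> as a function of the rescaled
  height.\<close>

lemma binomial_tail_has_real_derivative:
  assumes "k < n"
  shows "(binomial_tail n k has_real_derivative
     real (Suc k) * real (n choose Suc k) * ((1 - s) ^ (n - 1 - k) * s ^ k)) (at s)"
proof -
  define u where "u j = real j * real (n choose j) * (s ^ (j - 1) * (1 - s) ^ (n - j))" for j
  have d: "(Bernstein n j has_real_derivative u j - u (Suc j)) (at s)" if "j \<le> n" for j
  proof -
    have c: "real (Suc j) * real (n choose Suc j) = real (n - j) * real (n choose j)"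
      using binomial_absorption[of j n] binomial_absorb_comp[of n j] by (metis of_nat_mult)
    have "(Bernstein n j has_real_derivative
        real (n choose j) * (real j * s ^ (j - 1) * (1 - s) ^ (n - j)
          - s ^ j * (real (n - j) * (1 - s) ^ (n - j - 1)))) (at s)"
      unfolding Bernstein_def
      by (rule derivative_eq_intros refl | simp)+ (simp add: algebra_simps)
    moreover have "u (Suc j) = real (n - j) * real (n choose j) * (s ^ j * (1 - s) ^ (n - j - 1))"
      unfolding u_def c by simp
    ultimately show ?thesis
      by (simp add: u_def algebra_simps)
  qed
  have "(binomial_tail n k has_real_derivative (\<Sum>j=Suc k..n. u j - u (Suc j))) (at s)"
    unfolding binomial_tail_def by (intro DERIV_sum d) simp
  also have "(\<Sum>j=Suc k..n. u j - u (Suc j)) = u (Suc k) - u (Suc n)"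
    using sum_Suc_diff[of "Suc k" n "\<lambda>j. - u j"] assms by simp
  also have "\<dots> = real (Suc k) * real (n choose Suc k) * ((1 - s) ^ (n - 1 - k) * s ^ k)"
    by (simp add: u_def mult_ac)
  finally show ?thesis .
qed

lemma binomial_tail_0: "binomial_tail n k 0 = 0"
  by (simp add: binomial_tail_def Bernstein_def)

lemma binomial_tail_1: "k < n \<Longrightarrow> binomial_tail n k 1 = 1"
proof -
  assume "k < n"
  have "binomial_tail n k 1 = (\<Sum>j=Suc k..n. if j = n then 1 else 0)"
    unfolding binomial_tail_def by (intro sum.cong) (auto simp: Bernstein_def power_0_left)
  with \<open>k < n\<close> show ?thesis by simp
qed

lemma one_minus_binomial_tail:
  assumes "k < n"
  shows "1 - binomial_tail n k s = (\<Sum>i\<le>k. Bernstein n i s)"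
proof -
  have "1 = (\<Sum>i\<le>n. Bernstein n i s)" by simp
  also have "{..n} = {..k} \<union> {Suc k..n}" using assms by auto
  also have "(\<Sum>i\<in>{..k} \<union> {Suc k..n}. Bernstein n i s) = (\<Sum>i\<le>k. Bernstein n i s) + binomial_tail n k s"
    unfolding binomial_tail_def by (rule sum.union_disjoint) auto
  finally show ?thesis by simp
qed

lemma binomial_tail_bounds:
  assumes "0 \<le> s" "s \<le> 1" "k < n"
  shows "0 \<le> binomial_tail n k s" "binomial_tail n k s \<le> 1"
proof -
  show "0 \<le> binomial_tail n k s"
    unfolding binomial_tail_def using assms by (intro sum_nonneg Bernstein_nonneg)
  have "0 \<le> 1 - binomial_tail n k s"
    unfolding one_minus_binomial_tail[OF assms(3)] using assms by (intro sum_nonneg Bernstein_nonneg)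
  then show "binomial_tail n k s \<le> 1" by simp
qed

text \<open>The expectation of a binomial variable, obtained by summing the probabilities of
  exceeding \<open>k\<close>.\<close>

lemma sum_binomial_tail: "(\<Sum>k<n. binomial_tail n k s) = real n * s"
proof -
  have "(\<Sum>k<n. binomial_tail n k s) = (\<Sum>k<n. \<Sum>j\<le>n. if k < j then Bernstein n j s else 0)"
    unfolding binomial_tail_def
    by (intro sum.cong refl sum.mono_neutral_cong_left) auto
  also have "\<dots> = (\<Sum>j\<le>n. \<Sum>k<n. if k < j then Bernstein n j s else 0)"
    by (rule sum.swap)
  also have "\<dots> = (\<Sum>j\<le>n. real j * Bernstein n j s)"
  proof (rule sum.cong)
    fix j assume "j \<in> {..n}"
    then have "{k\<in>{..<n}. k < j} = {..<j}" by auto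
    then show "(\<Sum>k<n. if k < j then Bernstein n j s else 0) = real j * Bernstein n j s"
      by (simp add: sum.If_cases Int_def)
  qed simp
  also have "\<dots> = real n * s"
    by (rule sum_k_Bernstein)
  finally show ?thesis .
qed

text \<open>For independent copies \<open>X\<close> and \<open>X'\<close> of a binomial variable,
  the expectation of the square of \<open>X - X'\<close> is twice the variance. The proof expands
  the square and inserts the first two moments.\<close>

lemma Bernstein_variance:
  "(\<Sum>i\<le>n. \<Sum>j\<le>n. Bernstein n i s * Bernstein n j s * (real j - real i)\<^sup>2) = 2 * (real n * s * (1 - s))"
proof -
  let ?B = "\<lambda>i. Bernstein n i s"
  have kk: "(\<Sum>k\<le>n. (real k)\<^sup>2 * ?B k) = real n * (real n - 1) * s\<^sup>2 + real n * s"
  proof -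
    have "(\<Sum>k\<le>n. (real k)\<^sup>2 * ?B k) = (\<Sum>k\<le>n. real k * (real k - 1) * ?B k) + (\<Sum>k\<le>n. real k * ?B k)"
      unfolding sum.distrib[symmetric] by (intro sum.cong) (auto simp: power2_eq_square algebra_simps)
    then show ?thesis by (simp only: sum_kk_Bernstein sum_k_Bernstein)
  qed
  have "(\<Sum>i\<le>n. \<Sum>j\<le>n. ?B i * ?B j * (real j - real i)\<^sup>2) =
      (\<Sum>i\<le>n. \<Sum>j\<le>n. ?B i * ((real j)\<^sup>2 * ?B j) + ((real i)\<^sup>2 * ?B i) * ?B j - 2 * ((real i * ?B i) * (real j * ?B j)))"
    by (intro sum.cong refl) (simp add: power2_diff algebra_simps)
  also have "\<dots> = (\<Sum>i\<le>n. ?B i) * (\<Sum>k\<le>n. (real k)\<^sup>2 * ?B k) + (\<Sum>k\<le>n. (real k)\<^sup>2 * ?B k) * (\<Sum>i\<le>n. ?B i)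
      - 2 * ((\<Sum>k\<le>n. real k * ?B k) * (\<Sum>k\<le>n. real k * ?B k))"
    by (simp only: sum.distrib sum_subtractf sum_distrib_left[symmetric] sum_distrib_right[symmetric])
  also have "\<dots> = 2 * (real n * s * (1 - s))"
    unfolding kk sum_k_Bernstein sum_Bernstein by (simp add: power2_eq_square algebra_simps)
  finally show ?thesis .
qed

text \<open>If \<open>X\<close> and \<open>X'\<close> are independent binomial variables then the left-hand side is the
  expectation of the positive part of \<open>X - X'\<close>.\<close>
lemma sum_binomial_tail_variance_le:
  assumes s: "0 \<le> s" "s \<le> 1" and n: "0 < n"
  shows "(\<Sum>k<n. binomial_tail n k s * (1 - binomial_tail n k s)) \<le> sqrt (real n)"
proof -
  let ?B = "\<lambda>i. Bernstein n i s"
  have B: "0 \<le> ?B i" for i using s by (rule Bernstein_nonneg)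
  have "(\<Sum>k<n. binomial_tail n k s * (1 - binomial_tail n k s)) =
      (\<Sum>k<n. \<Sum>i\<le>n. \<Sum>j\<le>n. if i \<le> k \<and> k < j then ?B i * ?B j else 0)"
  proof (rule sum.cong)
    fix k assume "k \<in> {..<n}"
    then have k: "k < n" by simp
    have 1: "binomial_tail n k s = (\<Sum>j\<le>n. if k < j then ?B j else 0)"
      unfolding binomial_tail_def by (intro sum.mono_neutral_cong_left) auto
    have 2: "1 - binomial_tail n k s = (\<Sum>i\<le>n. if i \<le> k then ?B i else 0)"
      unfolding one_minus_binomial_tail[OF k] using k by (intro sum.mono_neutral_cong_left) auto
    have "binomial_tail n k s * (1 - binomial_tail n k s) =
        (\<Sum>i\<le>n. if i \<le> k then ?B i else 0) * (\<Sum>j\<le>n. if k < j then ?B j else 0)"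
      using 1 2 by (metis mult.commute)
    also have "\<dots> = (\<Sum>i\<le>n. \<Sum>j\<le>n. if i \<le> k \<and> k < j then ?B i * ?B j else 0)"
      unfolding sum_product by (intro sum.cong refl) auto
    finally show "binomial_tail n k s * (1 - binomial_tail n k s) =
        (\<Sum>i\<le>n. \<Sum>j\<le>n. if i \<le> k \<and> k < j then ?B i * ?B j else 0)" .
  qed simp
  also have "\<dots> = (\<Sum>i\<le>n. \<Sum>k<n. \<Sum>j\<le>n. if i \<le> k \<and> k < j then ?B i * ?B j else 0)"
    by (rule sum.swap)
  also have "\<dots> = (\<Sum>i\<le>n. \<Sum>j\<le>n. \<Sum>k<n. if i \<le> k \<and> k < j then ?B i * ?B j else 0)"
    by (intro sum.cong refl sum.swap)
  \<comment> \<open>Exactly the \<open>k\<close> with \<open>i \<le> k < j\<close> contribute.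
    Subtraction on \<open>nat\<close> is truncated, so \<open>j - i\<close> already is the positive
    part.\<close>
  also have "\<dots> = (\<Sum>i\<le>n. \<Sum>j\<le>n. ?B i * ?B j * real (j - i))"
  proof (intro sum.cong refl)
    fix i j assume "i \<in> {..n}" "j \<in> {..n}"
    then have "{..<n} \<inter> {k. i \<le> k \<and> k < j} = {i..<j}" by auto
    then show "(\<Sum>k<n. if i \<le> k \<and> k < j then ?B i * ?B j else 0) = ?B i * ?B j * real (j - i)"
      by (simp add: sum.If_cases)
  qed
  \<comment> \<open>The inequality of arithmetic and geometric means at scale
    \<open>sqrt (real n)\<close>, the order of the standard deviation, bounds the positive part by a
    quantity whose expectation \<open>Bernstein_variance\<close> provides.\<close>
  also have "\<dots> \<le> (\<Sum>i\<le>n. \<Sum>j\<le>n. ?B i * ?B j * ((sqrt (real n) + (real j - real i)\<^sup>2 / sqrt (real n)) / 2))"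
  proof (intro sum_mono mult_left_mono)
    fix i j :: nat
    let ?r = "sqrt (real n)" and ?d = "real j - real i"
    have r: "0 < ?r" using n by simp
    have "0 \<le> (?d - ?r)\<^sup>2" by simp
    then have "2 * ?d * ?r \<le> ?r * ?r + ?d\<^sup>2" by (simp add: power2_eq_square algebra_simps)
    then have "2 * ?d \<le> (?r * ?r + ?d\<^sup>2) / ?r" using r by (subst pos_le_divide_eq) auto
    also have "\<dots> = ?r + ?d\<^sup>2 / ?r" by (simp add: add_divide_distrib real_div_sqrt)
    finally have "?d \<le> (?r + ?d\<^sup>2 / ?r) / 2" by (subst pos_le_divide_eq) (simp_all add: mult.commute)
    moreover have "0 \<le> (?r + ?d\<^sup>2 / ?r) / 2" using r by simp
    ultimately show "real (j - i) \<le> (?r + ?d\<^sup>2 / ?r) / 2"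
      by (cases "i \<le> j") (auto simp: of_nat_diff)
  qed (simp add: B)
  also have "\<dots> = (sqrt (real n) * ((\<Sum>i\<le>n. ?B i) * (\<Sum>j\<le>n. ?B j))
      + (\<Sum>i\<le>n. \<Sum>j\<le>n. ?B i * ?B j * (real j - real i)\<^sup>2) / sqrt (real n)) / 2"
  proof -
    have "?B i * ?B j * ((sqrt (real n) + (real j - real i)\<^sup>2 / sqrt (real n)) / 2) =
        (sqrt (real n) * (?B i * ?B j) + ?B i * ?B j * (real j - real i)\<^sup>2 / sqrt (real n)) / 2" for i j
      by (simp add: algebra_simps)
    then show ?thesis
      by (simp only: sum.distrib sum_divide_distrib[symmetric] sum_distrib_left[symmetric] sum_distrib_right[symmetric])
  qed
  also have "\<dots> = (sqrt (real n) + 2 * (s * (1 - s)) * sqrt (real n)) / 2"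
  proof -
    have "2 * (real n * s * (1 - s)) / sqrt (real n) = 2 * (s * (1 - s)) * (real n / sqrt (real n))"
      by simp
    then show ?thesis
      unfolding Bernstein_variance sum_Bernstein by (simp add: real_div_sqrt)
  qed
  also have "\<dots> \<le> sqrt (real n)"
  proof -
    have "0 \<le> (s - 1/2)\<^sup>2" by simp
    then have "2 * (s * (1 - s)) \<le> 1" by (simp add: power2_eq_square algebra_simps)
    then have "2 * (s * (1 - s)) * sqrt (real n) \<le> 1 * sqrt (real n)" by (intro mult_right_mono) auto
    then show ?thesis by simp
  qed
  finally show ?thesis .
qed

section \<open>Moment generating functions of Bernoulli sums\<close>

lemma exp_le_quadratic:
  fixes x :: real
  assumes "\<bar>x\<bar> \<le> 1"
  shows "exp x \<le> 1 + x + x\<^sup>2"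
proof (cases "0 \<le> x")
  case True
  with assms show ?thesis by (intro exp_bound) auto
next
  case False
  define y where "y = - x"
  have y: "0 < y" using False by (simp add: y_def)
  have "exp x = 1 / exp y" by (simp add: y_def exp_minus field_simps)
  also have "\<dots> \<le> 1 / (1 + y)"
    using y by (intro divide_left_mono) auto
  also have "\<dots> \<le> 1 - y + y\<^sup>2"
  proof -
    have "(1 - y + y\<^sup>2) * (1 + y) = 1 + y ^ 3" by (simp add: power2_eq_square power3_eq_cube algebra_simps)
    with y show ?thesis by (simp add: pos_divide_le_eq)
  qed
  finally show ?thesis by (simp add: y_def)
qed

text \<open>After centring by \<open>exp (- t * p)\<close> the linear terms of the two quadratic
  bounds cancel and only the variance remains. Keeping \<open>p * (1 - p)\<close> is essential: a
  bound uniform in \<open>p\<close>, as in Hoeffding's lemma, would sum to order \<open>n\<close>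
  instead of \<open>sqrt n\<close>.\<close>

lemma bernoulli_mgf_le:
  fixes p t :: real
  assumes p: "0 \<le> p" "p \<le> 1" and t: "\<bar>t\<bar> \<le> 1"
  shows "1 + (exp t - 1) * p \<le> exp (t * p + t\<^sup>2 * (p * (1 - p)))"
proof -
  have "\<bar>t * (1 - p)\<bar> \<le> 1 * 1" "\<bar>- t * p\<bar> \<le> 1 * 1"
    unfolding abs_mult using p t by (intro mult_mono; simp)+
  then have e: "exp (t * (1 - p)) \<le> 1 + t * (1 - p) + (t * (1 - p))\<^sup>2" "exp (- t * p) \<le> 1 + - t * p + (- t * p)\<^sup>2"
    by (intro exp_le_quadratic; simp)+
  have "(1 + (exp t - 1) * p) * exp (- t * p) = p * exp (t * (1 - p)) + (1 - p) * exp (- t * p)"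
  proof -
    have "t * (1 - p) = t + - t * p" by (simp add: algebra_simps)
    then have "exp (t * (1 - p)) = exp t * exp (- t * p)" by (simp only: exp_add)
    then show ?thesis by (simp add: algebra_simps)
  qed
  also have "\<dots> \<le> p * (1 + t * (1 - p) + (t * (1 - p))\<^sup>2) + (1 - p) * (1 + - t * p + (- t * p)\<^sup>2)"
    using p e by (intro add_mono mult_left_mono) auto
  also have "\<dots> = 1 + t\<^sup>2 * (p * (1 - p))"
    by (simp add: power2_eq_square algebra_simps)
  also have "\<dots> \<le> exp (t\<^sup>2 * (p * (1 - p)))"
    by (rule exp_ge_add_one_self)
  finally have "(1 + (exp t - 1) * p) * exp (- t * p) * exp (t * p) \<le> exp (t\<^sup>2 * (p * (1 - p))) * exp (t * p)"
    by (intro mult_right_mono) auto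
  then show ?thesis
    by (simp add: mult.assoc exp_add[symmetric] add.commute)
qed

lemma prod_bernoulli_mgf_le:
  assumes s: "0 \<le> s" "s \<le> 1" and n: "0 < n" and t: "\<bar>t\<bar> \<le> 1"
  shows "(\<Prod>k<n. 1 + (exp t - 1) * binomial_tail n k s) \<le> exp (t * (real n * s) + t\<^sup>2 * sqrt (real n))"
proof -
  let ?p = "\<lambda>k. binomial_tail n k s"
  have "(\<Prod>k<n. 1 + (exp t - 1) * ?p k) \<le> (\<Prod>k<n. exp (t * ?p k + t\<^sup>2 * (?p k * (1 - ?p k))))"
  proof (intro prod_mono conjI)
    fix k assume "k \<in> {..<n}"
    then have p: "0 \<le> ?p k" "?p k \<le> 1" using s by (auto intro: binomial_tail_bounds)
    then show "1 + (exp t - 1) * ?p k \<le> exp (t * ?p k + t\<^sup>2 * (?p k * (1 - ?p k)))"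
      by (intro bernoulli_mgf_le t)
    have "0 \<le> (1 - ?p k) + exp t * ?p k" using p by simp
    then show "0 \<le> 1 + (exp t - 1) * ?p k" by (simp add: algebra_simps)
  qed
  also have "\<dots> = exp (t * (\<Sum>k<n. ?p k) + t\<^sup>2 * (\<Sum>k<n. ?p k * (1 - ?p k)))"
    unfolding sum_distrib_left sum.distrib[symmetric] by (rule exp_sum[symmetric]) simp
  also have "\<dots> \<le> exp (t * (real n * s) + t\<^sup>2 * sqrt (real n))"
    unfolding sum_binomial_tail exp_le_cancel_iff
    using sum_binomial_tail_variance_le[OF s n] by (intro add_left_mono mult_left_mono) auto
  finally show ?thesis .
qed

text \<open>The weight is 1 plus \<open>c - 1\<close> times the indicator of an initial interval, so
  the integral is a complete beta integral plus a multiple of an incomplete one. Both come from the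
  antiderivative \<open>binomial_tail\<close>.\<close>

lemma integral_beta_two_values:
  fixes b c :: real
  assumes k: "k < n"
  shows "(\<integral>x. indicator {0..1} x * ((if 2 * x - 1 \<le> b then c else 1) * ((1 - x) ^ (n - 1 - k) * x ^ k)) \<partial>lborel)
    = (1 + (c - 1) * binomial_tail n k (min 1 (max 0 ((1 + b) / 2)))) / (real (Suc k) * real (n choose Suc k))"
proof -
  let ?C = "real (Suc k) * real (n choose Suc k)"
  let ?g = "\<lambda>x. (1 - x) ^ (n - 1 - k) * x ^ k :: real"
  define s where "s = min 1 (max 0 ((1 + b) / 2))"
  have s: "0 \<le> s" "s \<le> 1" by (auto simp: s_def)
  have C: "0 < ?C" using k by (simp add: zero_less_binomial)
  have cont: "continuous_on A ?g" for A :: "real set" by (intro continuous_intros)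
  have FTC: "(\<integral>x. ?g x * indicator {0..r} x \<partial>lborel) = binomial_tail n k r / ?C"
       "integrable lborel (\<lambda>x. ?g x * indicator {0..r} x)" if "0 \<le> r" for r
  proof -
    have "((\<lambda>x. binomial_tail n k x / ?C) has_real_derivative ?g x) (at x)" for x
    proof -
      have "?C * ?g x / ?C = ?g x" using C by (intro nonzero_mult_div_cancel_left) linarith
      with DERIV_cdivide[OF binomial_tail_has_real_derivative[OF k, of x], of ?C] show ?thesis
        by (simp only:)
    qed
    then have "has_bochner_integral lborel (\<lambda>x. ?g x * indicator {0..r} x) (binomial_tail n k r / ?C - binomial_tail n k 0 / ?C)"
      using that by (intro has_bochner_integral_FTC_Icc_real) (auto intro!: continuous_intros)
    then show "(\<integral>x. ?g x * indicator {0..r} x \<partial>lborel) = binomial_tail n k r / ?C"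
       "integrable lborel (\<lambda>x. ?g x * indicator {0..r} x)"
      by (auto simp: binomial_tail_0 has_bochner_integral_iff)
  qed
  have "(\<integral>x. indicator {0..1} x * ((if 2 * x - 1 \<le> b then c else 1) * ?g x) \<partial>lborel)
     = (\<integral>x. ?g x * indicator {0..1} x + (c - 1) * (?g x * indicator {0..s} x) \<partial>lborel)"
  proof (rule integral_cong_AE)
    \<comment> \<open>The point 0 is exceptional: for \<open>b < -1\<close> clamping gives
      \<open>s = 0\<close>, and \<open>{0..s}\<close> still contains 0 although the condition on
      \<open>b\<close> fails there.\<close>
    show "AE x in lborel. indicator {0..1} x * ((if 2 * x - 1 \<le> b then c else 1) * ?g x)
        = ?g x * indicator {0..1} x + (c - 1) * (?g x * indicator {0..s} x)"
      using AE_lborel_singleton[of "0::real"]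
    proof eventually_elim
      case (elim x)
      have "x \<in> {0..s} \<longleftrightarrow> x \<in> {0..1} \<and> 2 * x - 1 \<le> b"
        using elim by (auto simp: s_def min_def max_def split: if_splits)
      then show ?case by (auto simp: indicator_def algebra_simps)
    qed
  qed measurable
  also have "\<dots> = binomial_tail n k 1 / ?C + (c - 1) * (binomial_tail n k s / ?C)"
    using FTC[of 1] FTC[of s] s by simp
  also have "\<dots> = (1 + (c - 1) * binomial_tail n k s) / ?C"
    by (simp add: binomial_tail_1[OF k] add_divide_distrib)
  finally show ?thesis by (simp only: s_def)
qed

section \<open>The moment generating function of cap counts\<close>

abbreviation sphere_power :: "nat \<Rightarrow> (nat \<Rightarrow> real^3) measure" where
  "sphere_power n \<equiv> \<Pi>\<^sub>M i\<in>{..<n}. area_S2"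

definition ensemble_weight :: "nat \<Rightarrow> (nat \<Rightarrow> real^3) \<Rightarrow> real" where
  "ensemble_weight n p = (\<Prod>j<n. \<Prod>i<j. (norm (p i - p j))\<^sup>2)"

text \<open>Distances do not change under \<open>T\<close>, so the spinors may be taken at the
  rotated points. This freedom is what later places the axis of a given cap at the pole.\<close>

lemma ensemble_weight_eq_det:
  assumes T: "orthogonal_transformation T" and p: "\<And>i. i < n \<Longrightarrow> p i \<in> S2"
  shows "ensemble_weight n p = (\<Prod>j<n. \<Prod>i<j. 4) *
    (cmod (\<Sum>\<sigma> | \<sigma> permutes {..<n}. of_int (sign \<sigma>) * (\<Prod>i<n. sphere_monomial (n - 1) (\<sigma> i) (T (p i)))))\<^sup>2"
proof -
  have TS: "T (p i) \<in> S2" if "i < n" for i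
    using p[OF that] by (simp add: orthogonal_transformation_norm[OF T])
  have Td: "norm (p i - p j) = norm (T (p i) - T (p j))" for i j
    using orthogonal_transformation_norm[OF T, of "p i - p j"]
    by (simp add: linear_diff[OF orthogonal_transformation_linear[OF T]])
  let ?D = "\<lambda>i j. spinor_fst (T (p i)) * spinor_snd (T (p j)) - spinor_fst (T (p j)) * spinor_snd (T (p i))"
  have "ensemble_weight n p = (\<Prod>j<n. \<Prod>i<j. 4 * (cmod (?D i j))\<^sup>2)"
    unfolding ensemble_weight_def Td
    by (intro prod.cong refl chordal_distance_spinor TS) auto
  also have "\<dots> = (\<Prod>j<n. \<Prod>i<j. 4) * (cmod (\<Prod>j<n. \<Prod>i<j. ?D i j))\<^sup>2"
    by (simp only: prod.distrib prod_norm[symmetric] prod_power_distrib)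
  also have "(\<Prod>j<n. \<Prod>i<j. ?D i j) =
      (\<Sum>\<sigma> | \<sigma> permutes {..<n}. of_int (sign \<sigma>) * (\<Prod>i<n. sphere_monomial (n - 1) (\<sigma> i) (T (p i))))"
    unfolding vandermonde_hom_expansion sphere_monomial_def ..
  finally show ?thesis .
qed

text \<open>A factor \<open>sqrt (w ...)\<close> is attached to each function, so the weighted
  density is still the squared modulus of one determinant. Because \<open>w\<close> sees only the
  height, the modified functions remain orthogonal, and the Gram formula applies.\<close>

lemma ensemble_partition_function:
  fixes w :: "real \<Rightarrow> real" and T :: "real^3 \<Rightarrow> real^3"
  assumes T: "orthogonal_transformation T"
    and [measurable]: "w \<in> borel_measurable borel" and w: "\<And>x. 0 \<le> w x" "\<And>x. w x \<le> B"
  shows "integrable (sphere_power n) (\<lambda>p. ensemble_weight n p * (\<Prod>i<n. w (T (p i) $ 3)))"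
    and "(\<integral>p. ensemble_weight n p * (\<Prod>i<n. w (T (p i) $ 3)) \<partial>sphere_power n) =
     (\<Prod>j<n. \<Prod>i<j. 4) * (fact n * (\<Prod>k<n. \<integral>p. w (p $ 3) * (cmod (sphere_monomial (n - 1) k p))\<^sup>2 \<partial>area_S2))"
proof -
  let ?\<psi> = "\<lambda>k p. of_real (sqrt (w (T p $ 3))) * sphere_monomial (n - 1) k (T p)"
  let ?D = "\<lambda>p. \<Sum>\<sigma> | \<sigma> permutes {..<n}. of_int (sign \<sigma>) * (\<Prod>i<n. ?\<psi> (\<sigma> i) (p i))"
  let ?K = "\<Prod>j<n. \<Prod>i<j. 4 :: real"
  note T_meas = distr_area_S2_orthogonal(1)[OF T] and T_distr = distr_area_S2_orthogonal(2)[OF T]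
  have psi_prod: "?\<psi> k p * cnj (?\<psi> l p) = (\<lambda>p. of_real (w (p $ 3)) *
      (sphere_monomial (n - 1) k p * cnj (sphere_monomial (n - 1) l p))) (T p)" for k l p
  proof -
    have "complex_of_real (w (T p $ 3)) = of_real (sqrt (w (T p $ 3))) * of_real (sqrt (w (T p $ 3)))"
      unfolding of_real_mult[symmetric] using w(1) by simp
    then show ?thesis by (simp add: mult_ac)
  qed
  have weight: "ensemble_weight n p * (\<Prod>i<n. w (T (p i) $ 3)) = ?K * (cmod (?D p))\<^sup>2"
    if "p \<in> space (sphere_power n)" for p
  proof -
    have "p i \<in> S2" if "i < n" for i
      using \<open>p \<in> space (sphere_power n)\<close> that by (auto simp: space_PiM space_area_S2 PiE_iff)
    note * = ensemble_weight_eq_det[OF T this]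
    have "?D p = (\<Prod>i<n. of_real (sqrt (w (T (p i) $ 3)))) *
      (\<Sum>\<sigma> | \<sigma> permutes {..<n}. of_int (sign \<sigma>) * (\<Prod>i<n. sphere_monomial (n - 1) (\<sigma> i) (T (p i))))"
      unfolding sum_distrib_left by (intro sum.cong refl) (simp add: prod.distrib mult_ac)
    moreover have "(cmod (\<Prod>i<n. of_real (sqrt (w (T (p i) $ 3)))))\<^sup>2 = (\<Prod>i<n. w (T (p i) $ 3))"
      using w(1) by (simp add: prod_norm[symmetric] prod_power_distrib)
    ultimately show ?thesis
      by (simp add: * norm_mult power_mult_distrib mult_ac)
  qed
  have fin: "sigma_finite_measure area_S2" ..
  have wB: "\<bar>w x\<bar> \<le> B" for x using w(1)[of x] w(2)[of x] by simp
  have int: "integrable area_S2 (\<lambda>p. ?\<psi> k p * cnj (?\<psi> l p))" for k l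
    unfolding psi_prod
    by (rule integrable_distr[OF T_meas], unfold T_distr, rule integrable_sphere_monomial[OF assms(2) wB])
  have integral: "(\<integral>p. ?\<psi> k p * cnj (?\<psi> l p) \<partial>area_S2) =
      (\<integral>p. of_real (w (p $ 3)) * (sphere_monomial (n - 1) k p * cnj (sphere_monomial (n - 1) l p)) \<partial>area_S2)" for k l
    unfolding psi_prod by (subst integral_distr[OF T_meas, symmetric]) (simp_all add: T_distr)
  have orth: "(\<integral>p. ?\<psi> k p * cnj (?\<psi> l p) \<partial>area_S2) = 0" if "k < n" "l < n" "k \<noteq> l" for k l
    unfolding integral using that by (intro sphere_monomial_orthogonal) auto
  have diag: "(\<integral>p. (cmod (?\<psi> k p))\<^sup>2 \<partial>area_S2) = (\<integral>p. w (p $ 3) * (cmod (sphere_monomial (n - 1) k p))\<^sup>2 \<partial>area_S2)" for k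
  proof -
    have "complex_of_real (\<integral>p. (cmod (?\<psi> k p))\<^sup>2 \<partial>area_S2) = (\<integral>p. ?\<psi> k p * cnj (?\<psi> k p) \<partial>area_S2)"
      unfolding integral_complex_of_real[symmetric] complex_norm_square ..
    also have "\<dots> = complex_of_real (\<integral>p. w (p $ 3) * (cmod (sphere_monomial (n - 1) k p))\<^sup>2 \<partial>area_S2)"
      unfolding integral integral_complex_of_real[symmetric] of_real_mult complex_norm_square ..
    finally show ?thesis by (simp only: of_real_eq_iff)
  qed
  have "integrable (sphere_power n) (\<lambda>p. ?K * (cmod (?D p))\<^sup>2)"
    by (intro integrable_mult_right integral_norm_det_orthogonal(1)[OF fin int orth])
  then show "integrable (sphere_power n) (\<lambda>p. ensemble_weight n p * (\<Prod>i<n. w (T (p i) $ 3)))"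
    by (subst Bochner_Integration.integrable_cong[OF refl weight])
  have "(\<integral>p. ensemble_weight n p * (\<Prod>i<n. w (T (p i) $ 3)) \<partial>sphere_power n) = ?K * (\<integral>p. (cmod (?D p))\<^sup>2 \<partial>sphere_power n)"
    unfolding integral_mult_right_zero[symmetric] by (rule Bochner_Integration.integral_cong[OF refl weight])
  also have "(\<integral>p. (cmod (?D p))\<^sup>2 \<partial>sphere_power n) =
      fact n * (\<Prod>k<n. \<integral>p. (cmod (?\<psi> k p))\<^sup>2 \<partial>area_S2)"
    by (rule integral_norm_det_orthogonal(2)[OF fin int orth])
  finally show "(\<integral>p. ensemble_weight n p * (\<Prod>i<n. w (T (p i) $ 3)) \<partial>sphere_power n) =
     ?K * (fact n * (\<Prod>k<n. \<integral>p. w (p $ 3) * (cmod (sphere_monomial (n - 1) k p))\<^sup>2 \<partial>area_S2))"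
    by (simp only: diag)
qed

text \<open>The relative area of \<open>{x. a \<bullet> x \<le> b}\<close> on the sphere for unit
  \<open>a\<close>, as \<open>measure_cap\<close> shows. Clamping covers thresholds beyond the
  sphere, where the cap is empty or everything.\<close>

definition cap_fraction :: "real \<Rightarrow> real" where
  "cap_fraction b = min 1 (max 0 ((1 + b) / 2))"

lemma cap_fraction_bounds: "0 \<le> cap_fraction b" "cap_fraction b \<le> 1"
  by (auto simp: cap_fraction_def)

text \<open>Giving weight \<open>c\<close> to points in the cap and 1 to the others produces
  \<open>c\<close> to the power of the cap count, hence its generating function. The factor
  \<open>Z\<close> is fixed before \<open>c\<close>, so it can be eliminated by comparing two values
  of \<open>c\<close>.\<close>

lemma ensemble_partition_function_cap:
  fixes a :: "real^3"
  assumes a: "norm a = 1"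
  obtains Z where "\<And>c. 0 \<le> c \<Longrightarrow> integrable (sphere_power n) (\<lambda>p. ensemble_weight n p * (\<Prod>i<n. if a \<bullet> p i \<le> b then c else 1))"
    "\<And>c. 0 \<le> c \<Longrightarrow> (\<integral>p. ensemble_weight n p * (\<Prod>i<n. if a \<bullet> p i \<le> b then c else 1) \<partial>sphere_power n)
      = Z * (\<Prod>k<n. 1 + (c - 1) * binomial_tail n k (cap_fraction b))"
proof -
  have "norm a = norm (axis 3 1 :: real^3)" using a by simp
  then obtain T where T: "orthogonal_transformation T" "T a = (axis 3 1 :: real^3)"
    using that orthogonal_transformation_exists by blast
  have height: "T x $ 3 = a \<bullet> x" for x
  proof -
    have "a \<bullet> x = T a \<bullet> T x" using T(1) by (simp add: orthogonal_transformation_def)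
    then show ?thesis by (simp add: T(2) inner_axis')
  qed
  define Z where "Z = (\<Prod>j<n. \<Prod>i<j. 4 :: real) *
      (fact n * (\<Prod>k<n. 4 * pi / (real (Suc k) * real (n choose Suc k))))"
  let ?w = "\<lambda>c x. if x \<le> b then c else 1 :: real"
  have w: "?w c \<in> borel_measurable borel" for c by measurable
  show ?thesis
  proof (rule that[of Z])
    fix c :: real assume c: "0 \<le> c"
    have wc: "0 \<le> ?w c x" "?w c x \<le> max c 1" for x using c by auto
    note pf = ensemble_partition_function[where w = "?w c" and T = T and B = "max c 1" and n = n, OF T(1) w wc, unfolded height]
    show "integrable (sphere_power n) (\<lambda>p. ensemble_weight n p * (\<Prod>i<n. if a \<bullet> p i \<le> b then c else 1))"
      by (rule pf(1))
    have "(\<integral>p. ?w c (p $ 3) * (cmod (sphere_monomial (n - 1) k p))\<^sup>2 \<partial>area_S2) =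
       4 * pi / (real (Suc k) * real (n choose Suc k)) * (1 + (c - 1) * binomial_tail n k (cap_fraction b))"
      if "k < n" for k
      unfolding integral_norm_sphere_monomial[OF w] integral_beta_two_values[OF that] cap_fraction_def by simp
    then have "(\<Prod>k<n. \<integral>p. ?w c (p $ 3) * (cmod (sphere_monomial (n - 1) k p))\<^sup>2 \<partial>area_S2) =
       (\<Prod>k<n. 4 * pi / (real (Suc k) * real (n choose Suc k))) * (\<Prod>k<n. 1 + (c - 1) * binomial_tail n k (cap_fraction b))"
      unfolding prod.distrib[symmetric] by (intro prod.cong refl) simp
    then show "(\<integral>p. ensemble_weight n p * (\<Prod>i<n. if a \<bullet> p i \<le> b then c else 1) \<partial>sphere_power n)
      = Z * (\<Prod>k<n. 1 + (c - 1) * binomial_tail n k (cap_fraction b))"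
      unfolding pf(2) Z_def by (simp only: mult.assoc)
  qed
qed

section \<open>Concentration for a single cap\<close>

lemma spherical_ensemble_points:
  assumes "spherical_ensemble n \<Omega> P"
  shows "\<And>i. i < n \<Longrightarrow> P i \<in> \<Omega> \<rightarrow>\<^sub>M area_S2"
    "\<And>i \<omega>. i < n \<Longrightarrow> \<omega> \<in> space \<Omega> \<Longrightarrow> P i \<omega> \<in> S2"
proof -
  obtain c where "distributed \<Omega> (sphere_power n) (\<lambda>\<omega>. \<lambda>i\<in>{..<n}. P i \<omega>)
        (\<lambda>p. ennreal (c * (\<Prod>j<n. \<Prod>i<j. (norm (p i - p j))\<^sup>2)))"
    using assms unfolding spherical_ensemble_def by blast
  then have X: "(\<lambda>\<omega>. \<lambda>i\<in>{..<n}. P i \<omega>) \<in> \<Omega> \<rightarrow>\<^sub>M sphere_power n"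
    by (rule distributed_measurable)
  show P: "P i \<in> \<Omega> \<rightarrow>\<^sub>M area_S2" if "i < n" for i
    using measurable_compose[OF X measurable_component_singleton[of i]] that by simp
  show "P i \<omega> \<in> S2" if "i < n" "\<omega> \<in> space \<Omega>" for i \<omega>
    using measurable_space[OF P] that by (simp add: space_area_S2)
qed

lemma spherical_ensemble_mgf:
  assumes ens: "spherical_ensemble n \<Omega> P" and a: "norm a = 1"
  shows "integrable \<Omega> (\<lambda>\<omega>. exp (t * (\<Sum>j<n. indicator {x. a \<bullet> x \<le> b} (P j \<omega>))))"
    "(\<integral>\<omega>. exp (t * (\<Sum>j<n. indicator {x. a \<bullet> x \<le> b} (P j \<omega>))) \<partial>\<Omega>) =
      (\<Prod>k<n. 1 + (exp t - 1) * binomial_tail n k (cap_fraction b))"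
proof -
  interpret prob_space \<Omega> using ens by (simp add: spherical_ensemble_def)
  obtain c0 where c0: "c0 > 0" and "distributed \<Omega> (sphere_power n) (\<lambda>\<omega>. \<lambda>i\<in>{..<n}. P i \<omega>)
        (\<lambda>p. ennreal (c0 * (\<Prod>j<n. \<Prod>i<j. (norm (p i - p j))\<^sup>2)))"
    using ens unfolding spherical_ensemble_def by blast
  then have dist: "distributed \<Omega> (sphere_power n) (\<lambda>\<omega>. \<lambda>i\<in>{..<n}. P i \<omega>) (\<lambda>p. ennreal (c0 * ensemble_weight n p))"
    by (simp only: ensemble_weight_def)
  obtain Z where int: "\<And>c. 0 \<le> c \<Longrightarrow> integrable (sphere_power n) (\<lambda>p. ensemble_weight n p * (\<Prod>i<n. if a \<bullet> p i \<le> b then c else 1))"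
    and Z: "\<And>c. 0 \<le> c \<Longrightarrow> (\<integral>p. ensemble_weight n p * (\<Prod>i<n. if a \<bullet> p i \<le> b then c else 1) \<partial>sphere_power n)
      = Z * (\<Prod>k<n. 1 + (c - 1) * binomial_tail n k (cap_fraction b))"
    using ensemble_partition_function_cap[OF a] by blast
  let ?g = "\<lambda>c p. \<Prod>i<n. if a \<bullet> p i \<le> b then c else 1 :: real"
  have g: "?g c \<in> borel_measurable (sphere_power n)" for c
  proof (intro borel_measurable_prod)
    fix i assume "i \<in> {..<n}"
    then have p: "(\<lambda>p. p i) \<in> sphere_power n \<rightarrow>\<^sub>M area_S2" by (rule measurable_component_singleton)
    have "(\<lambda>x. if a \<bullet> x \<le> b then c else 1) \<in> borel_measurable area_S2"
      by (rule measurable_area_S2_borel) measurable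
    from measurable_compose[OF p this] show "(\<lambda>p. if a \<bullet> p i \<le> b then c else 1) \<in> borel_measurable (sphere_power n)" .
  qed
  have nonneg: "0 \<le> c0 * ensemble_weight n p" for p
    using c0 by (auto simp: ensemble_weight_def intro!: mult_nonneg_nonneg prod_nonneg)
  have g_P: "?g c (\<lambda>i\<in>{..<n}. P i \<omega>) = (\<Prod>i<n. if a \<bullet> P i \<omega> \<le> b then c else 1)" for c :: real and \<omega>
    by simp
  have E_int: "integrable \<Omega> (\<lambda>\<omega>. \<Prod>i<n. if a \<bullet> P i \<omega> \<le> b then c else 1)" if "0 \<le> c" for c :: real
    using distributed_integrable[OF dist g nonneg, of c] int[OF that] unfolding g_P by (simp add: mult.assoc)
  have E: "(\<integral>\<omega>. (\<Prod>i<n. if a \<bullet> P i \<omega> \<le> b then c else 1) \<partial>\<Omega>)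
      = c0 * (Z * (\<Prod>k<n. 1 + (c - 1) * binomial_tail n k (cap_fraction b)))" if "0 \<le> c" for c
    using distributed_integral[OF dist g nonneg, of c] Z[OF that] unfolding g_P by (simp add: mult.assoc)
  \<comment> \<open>At \<open>c = 1\<close> the integrand and the product over \<open>k\<close> are
    both 1, and \<open>\<Omega>\<close> has total mass 1. This eliminates the unknown constant of
    the density.\<close>
  have "c0 * Z = 1"
    using E[of 1] by (simp add: prob_space)
  then have E': "(\<integral>\<omega>. (\<Prod>i<n. if a \<bullet> P i \<omega> \<le> b then c else 1) \<partial>\<Omega>)
      = (\<Prod>k<n. 1 + (c - 1) * binomial_tail n k (cap_fraction b))" if "0 \<le> c" for c
    unfolding E[OF that] by (simp add: mult.assoc[symmetric])
  have exp_eq: "exp (t * (\<Sum>j<n. indicator {x. a \<bullet> x \<le> b} (P j \<omega>))) =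
      (\<Prod>i<n. if a \<bullet> P i \<omega> \<le> b then exp t else 1)" for \<omega>
    unfolding sum_distrib_left exp_sum[OF finite_lessThan] by (intro prod.cong refl) (simp add: indicator_def)
  show "integrable \<Omega> (\<lambda>\<omega>. exp (t * (\<Sum>j<n. indicator {x. a \<bullet> x \<le> b} (P j \<omega>))))"
    "(\<integral>\<omega>. exp (t * (\<Sum>j<n. indicator {x. a \<bullet> x \<le> b} (P j \<omega>))) \<partial>\<Omega>) =
      (\<Prod>k<n. 1 + (exp t - 1) * binomial_tail n k (cap_fraction b))"
    unfolding exp_eq using E_int[of "exp t"] E'[of "exp t"] by simp_all
qed

lemma spherical_ensemble_chernoff:
  fixes b :: real
  assumes ens: "spherical_ensemble n \<Omega> P" and a: "norm a = 1" and n: "0 < n" and t: "0 < t" "t \<le> 1"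
  defines "N \<equiv> \<lambda>\<omega>. \<Sum>j<n. indicator {x. a \<bullet> x \<le> b} (P j \<omega>) :: real"
  shows "measure \<Omega> {\<omega> \<in> space \<Omega>. u < \<bar>N \<omega> - real n * cap_fraction b\<bar>} \<le> 2 * exp (t\<^sup>2 * sqrt (real n) - t * u)"
proof -
  interpret prob_space \<Omega> using ens by (simp add: spherical_ensemble_def)
  let ?\<mu> = "real n * cap_fraction b"
  have mgf: "integrable \<Omega> (\<lambda>\<omega>. exp (t * N \<omega>))" "(\<integral>\<omega>. exp (t * N \<omega>) \<partial>\<Omega>) \<le> exp (t * ?\<mu> + t\<^sup>2 * sqrt (real n))"
    if "\<bar>t\<bar> \<le> 1" for t
    unfolding N_def using spherical_ensemble_mgf[OF ens a, of t b]
      prod_bernoulli_mgf_le[OF cap_fraction_bounds n that] by auto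
  have ind: "(\<lambda>x. indicator {x. a \<bullet> x \<le> b} x :: real) \<in> borel_measurable area_S2"
    by (rule measurable_area_S2_borel) measurable
  have N_meas: "N \<in> borel_measurable \<Omega>"
    unfolding N_def
    by (intro borel_measurable_sum measurable_compose[OF spherical_ensemble_points(1)[OF ens] ind]) simp
  have set_int: "set_integrable \<Omega> (space \<Omega>) f" if "integrable \<Omega> f" for f :: "_ \<Rightarrow> real"
    unfolding set_integrable_def using that by (subst Bochner_Integration.integrable_cong[OF refl, of _ _ f]) auto
  let ?A = "{\<omega> \<in> space \<Omega>. ?\<mu> + u \<le> N \<omega>}" and ?B = "{\<omega> \<in> space \<Omega>. N \<omega> \<le> ?\<mu> - u}"
  have "measure \<Omega> ?A \<le> exp (- t * (?\<mu> + u)) * (\<integral>\<omega>\<in>space \<Omega>. exp (t * N \<omega>) \<partial>\<Omega>)"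
    using t mgf(1)[of t] by (intro Chernoff_ineq_ge) (auto intro: set_int)
  also have "\<dots> \<le> exp (- t * (?\<mu> + u)) * exp (t * ?\<mu> + t\<^sup>2 * sqrt (real n))"
    using t mgf[of t] by (intro mult_left_mono) (auto simp: set_integral_space)
  also have "\<dots> = exp (t\<^sup>2 * sqrt (real n) - t * u)"
    by (simp add: exp_add[symmetric] algebra_simps)
  finally have A: "measure \<Omega> ?A \<le> exp (t\<^sup>2 * sqrt (real n) - t * u)" .
  have "measure \<Omega> ?B \<le> exp (t * (?\<mu> - u)) * (\<integral>\<omega>\<in>space \<Omega>. exp (- t * N \<omega>) \<partial>\<Omega>)"
    using t mgf(1)[of "- t"] by (intro Chernoff_ineq_le) (auto intro: set_int)
  also have "\<dots> \<le> exp (t * (?\<mu> - u)) * exp (- t * ?\<mu> + (- t)\<^sup>2 * sqrt (real n))"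
    using t mgf[of "- t"] by (intro mult_left_mono) (auto simp: set_integral_space)
  also have "\<dots> = exp (t\<^sup>2 * sqrt (real n) - t * u)"
    by (simp add: exp_add[symmetric] algebra_simps)
  finally have B: "measure \<Omega> ?B \<le> exp (t\<^sup>2 * sqrt (real n) - t * u)" .
  have AB: "?A \<in> sets \<Omega>" "?B \<in> sets \<Omega>"
    using N_meas by measurable
  have "measure \<Omega> {\<omega> \<in> space \<Omega>. u < \<bar>N \<omega> - ?\<mu>\<bar>} \<le> measure \<Omega> (?A \<union> ?B)"
    using AB by (intro finite_measure_mono sets.Un) auto
  also have "\<dots> \<le> measure \<Omega> ?A + measure \<Omega> ?B"
    by (rule measure_Un_le[OF AB])
  also have "\<dots> \<le> 2 * exp (t\<^sup>2 * sqrt (real n) - t * u)"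
    using A B by simp
  finally show ?thesis .
qed

lemma spherical_ensemble_cap_concentration:
  fixes b :: real
  assumes ens: "spherical_ensemble n \<Omega> P" and a: "norm a = 1" and n: "2 \<le> n" and C: "1 \<le> C"
  defines "N \<equiv> \<lambda>\<omega>. \<Sum>j<n. indicator {x. a \<bullet> x \<le> b} (P j \<omega>) :: real"
  shows "measure \<Omega> {\<omega> \<in> space \<Omega>. C * real n powr (1/4) * sqrt (ln (real n)) < \<bar>N \<omega> - real n * cap_fraction b\<bar>}
     \<le> 2 * real n powr (- C / 4)"
proof -
  define q where "q = real n powr (1/4)"
  define r where "r = sqrt (real n)"
  define L where "L = ln (real n)"
  define u where "u = C * q * sqrt L"
  have q: "0 < q" using n by (simp add: q_def)
  have r: "0 < r" using n by (simp add: r_def)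
  have L: "0 < L" using n by (simp add: L_def)
  have qq: "q\<^sup>2 = r"
    using n by (simp add: q_def r_def powr_half_sqrt[symmetric] power2_eq_square powr_add[symmetric])
  have u: "0 < u" using C q L by (simp add: u_def)
  have uu: "u\<^sup>2 = C\<^sup>2 * r * L" using L by (simp add: u_def power_mult_distrib qq)
  \<comment> \<open>Since \<open>ln n\<close> is at most a multiple of \<open>sqrt n\<close>, the
    deviation \<open>u\<close> dominates a multiple of \<open>C * L\<close>. This is needed when
    \<open>u\<close> is too large for the optimal Chernoff parameter.\<close>
  have "L = 2 * ln r" using n by (simp add: L_def r_def ln_sqrt)
  also have "ln r \<le> r - 1" using r by (rule ln_le_minus_one)
  finally have "L \<le> 2\<^sup>2 * r" using r by simp
  then have "sqrt L \<le> sqrt (2\<^sup>2 * r)" by (rule real_sqrt_le_mono)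
  also have "\<dots> = 2 * q" using q by (simp add: qq[symmetric] real_sqrt_mult)
  finally have "sqrt L * sqrt L \<le> 2 * q * sqrt L" using L by (intro mult_right_mono) auto
  then have "C * L \<le> C * (2 * q * sqrt L)" using L C by (intro mult_left_mono) auto
  then have u2: "C * L \<le> 2 * u" by (simp add: u_def mult_ac)
  \<comment> \<open>The minimiser of \<open>t\<^sup>2 * r - t * u\<close> is
    \<open>u / (2 * r)\<close>, with value \<open>- (u\<^sup>2 / (4 * r))\<close>. If it exceeds 1,
    then \<open>t = 1\<close> gives \<open>r - u < - u / 2\<close>, and \<open>u2\<close>
    finishes.\<close>
  obtain t where t: "0 < t" "t \<le> 1" "t\<^sup>2 * r - t * u \<le> - (C / 4) * L"
  proof (cases "u \<le> 2 * r")
    case True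
    let ?t = "u / (2 * r)"
    have "?t\<^sup>2 * r - ?t * u = - (u\<^sup>2 / (4 * r))"
      using r by (simp add: power2_eq_square field_simps)
    also have "u\<^sup>2 / (4 * r) = C\<^sup>2 * L / 4" using r by (simp add: uu)
    also have "- (C\<^sup>2 * L / 4) \<le> - (C / 4) * L"
    proof -
      have "C * 1 * L \<le> C * C * L" using C L by (intro mult_mono) auto
      then show ?thesis by (simp add: power2_eq_square)
    qed
    finally show ?thesis using that[of ?t] True u r by simp
  next
    case False
    then have "r - u \<le> - (C / 4) * L" using u2 by (simp add: field_simps)
    then show ?thesis using that[of 1] by simp
  qed
  have "measure \<Omega> {\<omega> \<in> space \<Omega>. u < \<bar>N \<omega> - real n * cap_fraction b\<bar>} \<le> 2 * exp (t\<^sup>2 * sqrt (real n) - t * u)"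
    unfolding N_def using n t by (intro spherical_ensemble_chernoff[OF ens a]) auto
  also have "\<dots> \<le> 2 * exp (- (C / 4) * L)"
    using t(3) by (simp add: r_def)
  also have "\<dots> = 2 * real n powr (- C / 4)"
    using n by (simp add: powr_def L_def)
  finally show ?thesis by (simp only: u_def q_def L_def)
qed

section \<open>A net of caps\<close>

lemma cap_fraction_minus: "cap_fraction (- b) = 1 - cap_fraction b"
  by (auto simp: cap_fraction_def min_def max_def field_simps)

lemma cap_fraction_mono: "b \<le> b' \<Longrightarrow> cap_fraction b \<le> cap_fraction b'"
  by (auto simp: cap_fraction_def min_def max_def field_simps)

lemma cap_fraction_add_le: "0 \<le> d \<Longrightarrow> cap_fraction (b + d) \<le> cap_fraction b + d / 2"
  by (auto simp: cap_fraction_def min_def max_def field_simps)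

lemma tendsto_cap_fraction: "(f \<longlongrightarrow> b) F \<Longrightarrow> ((\<lambda>x. cap_fraction (f x)) \<longlongrightarrow> cap_fraction b) F"
  unfolding cap_fraction_def by (intro tendsto_intros) auto

lemma sets_area_S2_halfspace:
  "S2 \<inter> {x. a \<bullet> x \<le> b} \<in> sets area_S2" "S2 \<inter> {x. a \<bullet> x < b} \<in> sets area_S2"
proof -
  have "S2 \<inter> {x. a \<bullet> x \<le> b} \<in> sets borel"
    by (intro sets.Int borel_closed closed_sphere closed_halfspace_le)
  moreover have "S2 \<inter> {x. a \<bullet> x < b} \<in> sets borel"
    by (intro sets.Int borel_closed[OF closed_sphere] borel_open[OF open_halfspace_lt])
  ultimately show "S2 \<inter> {x. a \<bullet> x \<le> b} \<in> sets area_S2" "S2 \<inter> {x. a \<bullet> x < b} \<in> sets area_S2"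
    by (auto simp: sets_area_S2 sets_restrict_space_iff)
qed

lemma measure_cap_gt:
  assumes a: "norm a = 1"
  shows "measure area_S2 {x \<in> S2. b < a \<bullet> x} = 4 * pi * (1 - cap_fraction b)"
proof -
  have "norm a = norm (axis 3 1 :: real^3)" using a by simp
  then obtain T where T: "orthogonal_transformation T" "T a = (axis 3 1 :: real^3)"
    using orthogonal_transformation_exists by blast
  have height: "T x $ 3 = a \<bullet> x" for x
  proof -
    have "a \<bullet> x = T a \<bullet> T x" using T(1) by (simp add: orthogonal_transformation_def)
    then show ?thesis by (simp add: T(2) inner_axis')
  qed
  have "{x \<in> S2. b < a \<bullet> x} = T -` {x \<in> S2. b < x $ 3} \<inter> space area_S2"
    by (auto simp: space_area_S2 height orthogonal_transformation_norm[OF T(1)])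
  then have "measure area_S2 {x \<in> S2. b < a \<bullet> x} = measure (distr area_S2 area_S2 T) {x \<in> S2. b < x $ 3}"
    by (simp only: measure_distr[OF distr_area_S2_orthogonal(1)[OF T(1)] sets_area_S2_gt])
  then show ?thesis
    by (simp only: distr_area_S2_orthogonal(2)[OF T(1)] measure_area_S2_gt cap_fraction_def)
qed

text \<open>The closed cap is the complement of an open cap with the same axis, while the open cap
  is an upper cap for the axis \<open>- a\<close>. No separate treatment of the boundary circle is
  required.\<close>

lemma measure_cap:
  assumes a: "norm a = 1"
  shows "measure area_S2 (S2 \<inter> {x. a \<bullet> x \<le> b}) = 4 * pi * cap_fraction b"
    and "measure area_S2 (S2 \<inter> {x. a \<bullet> x < b}) = 4 * pi * cap_fraction b"
proof -
  have eq: "space area_S2 - S2 \<inter> {x. a \<bullet> x \<le> b} = {x \<in> S2. b < a \<bullet> x}"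
    by (auto simp: space_area_S2)
  have "measure area_S2 (space area_S2 - S2 \<inter> {x. a \<bullet> x \<le> b}) =
      measure area_S2 (space area_S2) - measure area_S2 (S2 \<inter> {x. a \<bullet> x \<le> b})"
    by (rule area_S2.finite_measure_compl[OF sets_area_S2_halfspace(1)])
  then show "measure area_S2 (S2 \<inter> {x. a \<bullet> x \<le> b}) = 4 * pi * cap_fraction b"
    unfolding eq measure_cap_gt[OF a] unfolding space_area_S2 measure_area_S2_sphere by (simp add: algebra_simps)
  have "S2 \<inter> {x. a \<bullet> x < b} = {x \<in> S2. - b < (- a) \<bullet> x}" by auto
  then show "measure area_S2 (S2 \<inter> {x. a \<bullet> x < b}) = 4 * pi * cap_fraction b"
    using measure_cap_gt[of "- a" "- b"] a by (simp only: cap_fraction_minus norm_minus_cancel) simp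
qed

lemma halfspace_normalize:
  assumes "a \<noteq> (0 :: real^3)"
  shows "{x. a \<bullet> x \<le> b} = {x. (a /\<^sub>R norm a) \<bullet> x \<le> b / norm a}"
    "{x. a \<bullet> x < b} = {x. (a /\<^sub>R norm a) \<bullet> x < b / norm a}"
  using assms by (auto simp: field_simps)

definition cap_deviation :: "nat \<Rightarrow> (nat \<Rightarrow> real^3) \<Rightarrow> (real^3) set \<Rightarrow> real" where
  "cap_deviation n x D = \<bar>(\<Sum>j<n. indicator D (x j)) - real n * measure area_S2 D / (4 * pi)\<bar>"

lemma cap_discrepancy_le_iff: "cap_discrepancy n x \<le> u \<longleftrightarrow> (\<forall>D\<in>spherical_caps. cap_deviation n x D \<le> u)"
proof -
  have "{x. axis 1 1 \<bullet> x \<le> 0} \<in> halfspaces"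
    unfolding halfspaces_def by (auto intro!: exI[of _ "axis 1 1"])
  then have "spherical_caps \<noteq> {}"
    unfolding spherical_caps_def by blast
  moreover have "bdd_above (cap_deviation n x ` spherical_caps)"
    by (auto simp: cap_deviation_def intro!: bdd_aboveI[of _ "real n"] cap_deviation_le)
  moreover have "cap_discrepancy n x = (SUP D\<in>spherical_caps. cap_deviation n x D)"
    unfolding cap_discrepancy_def cap_deviation_def ..
  ultimately show ?thesis by (metis cSUP_le_iff)
qed

lemma spherical_caps_cases:
  assumes "D \<in> spherical_caps"
  obtains a b where "norm a = 1" "D = S2 \<inter> {x. a \<bullet> x \<le> b}" | a b where "norm a = 1" "D = S2 \<inter> {x. a \<bullet> x < b}"
proof -
  obtain H where H: "H \<in> halfspaces" "D = S2 \<inter> H"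
    using assms unfolding spherical_caps_def by blast
  from H(1) consider a b where "a \<noteq> 0" "H = {x. a \<bullet> x \<le> b}" | a b where "a \<noteq> 0" "H = {x. a \<bullet> x < b}"
    unfolding halfspaces_def by blast
  then show ?thesis
  proof cases
    case (1 a b)
    then show ?thesis
      using that(1)[of "a /\<^sub>R norm a" "b / norm a"] H(2) halfspace_normalize(1)[OF 1(1), of b] by simp
  next
    case (2 a b)
    then show ?thesis
      using that(2)[of "a /\<^sub>R norm a" "b / norm a"] H(2) halfspace_normalize(2)[OF 2(1), of b] by simp
  qed
qed

lemma cap_deviation_unit:
  assumes a: "norm a = 1" and x: "\<And>j. j < n \<Longrightarrow> x j \<in> S2"
  shows "cap_deviation n x (S2 \<inter> {x. a \<bullet> x \<le> b}) = \<bar>(\<Sum>j<n. indicator {x. a \<bullet> x \<le> b} (x j)) - real n * cap_fraction b\<bar>"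
    "cap_deviation n x (S2 \<inter> {x. a \<bullet> x < b}) = \<bar>(\<Sum>j<n. indicator {x. a \<bullet> x < b} (x j)) - real n * cap_fraction b\<bar>"
proof -
  have i: "(\<Sum>j<n. indicator (S2 \<inter> H) (x j)) = (\<Sum>j<n. indicator H (x j) :: real)" for H
    using x by (intro sum.cong refl) (auto simp: indicator_def)
  show "cap_deviation n x (S2 \<inter> {x. a \<bullet> x \<le> b}) = \<bar>(\<Sum>j<n. indicator {x. a \<bullet> x \<le> b} (x j)) - real n * cap_fraction b\<bar>"
    "cap_deviation n x (S2 \<inter> {x. a \<bullet> x < b}) = \<bar>(\<Sum>j<n. indicator {x. a \<bullet> x < b} (x j)) - real n * cap_fraction b\<bar>"
    unfolding cap_deviation_def i measure_cap[OF a] by simp_all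
qed

text \<open>Coordinates are rounded to a grid of width \<open>1 / (3 * m)\<close>, and
  \<open>inv_into\<close> selects one point of the sphere from each occupied cell, so the net
  consists of unit vectors. Three coordinate errors add up to \<open>1 / m\<close>; the base
  \<open>6 * m + 1\<close> counts the integers from \<open>- 3 * m\<close> to
  \<open>3 * m\<close>.\<close>

lemma sphere_net:
  assumes m: "0 < m"
  obtains A :: "(real^3) set" where "finite A" "card A \<le> (6 * m + 1) ^ 3" "\<And>a. a \<in> A \<Longrightarrow> norm a = 1"
    "\<And>v. norm v = 1 \<Longrightarrow> \<exists>a\<in>A. norm (v - a) \<le> 1 / real m"
proof -
  define r where "r v = (\<lfloor>3 * real m * v $ 1\<rfloor>, \<lfloor>3 * real m * v $ 2\<rfloor>, \<lfloor>3 * real m * v $ 3\<rfloor>)" for v :: "real^3"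
  let ?I = "{- int (3 * m)..int (3 * m)}"
  define A where "A = inv_into S2 r ` (r ` S2)"
  have I: "\<lfloor>3 * real m * v $ i\<rfloor> \<in> ?I" if "v \<in> S2" for v and i :: 3
  proof -
    have "\<bar>3 * real m * v $ i\<bar> \<le> 3 * real m * 1"
      unfolding abs_mult using nth_le_1_S2[OF that, of i] by (intro mult_mono) auto
    then have "real_of_int (- int (3 * m)) \<le> 3 * real m * v $ i" "3 * real m * v $ i \<le> real_of_int (int (3 * m))"
      by auto
    then show ?thesis
      by (auto simp: le_floor_iff intro: floor_le_iff[THEN iffD2] order.trans[OF floor_mono[of _ "real_of_int (int (3 * m))"]])
  qed
  then have sub: "r ` S2 \<subseteq> ?I \<times> ?I \<times> ?I" by (auto simp: r_def)
  have fin: "finite (?I \<times> ?I \<times> ?I)" by simp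
  have card: "card (?I \<times> ?I \<times> ?I) = (6 * m + 1) ^ 3"
    by (simp add: card_cartesian_product power3_eq_cube nat_add_distrib nat_mult_distrib)
  show ?thesis
  proof (rule that[of A])
    show "finite A" unfolding A_def using finite_subset[OF sub fin] by blast
    have "card A \<le> card (r ` S2)" unfolding A_def using finite_subset[OF sub fin] by (rule card_image_le)
    also have "\<dots> \<le> (6 * m + 1) ^ 3" using card_mono[OF fin sub] by (simp only: card)
    finally show "card A \<le> (6 * m + 1) ^ 3" .
    show "norm a = 1" if "a \<in> A" for a
      using that inv_into_into[of _ r S2] by (auto simp: A_def)
    show "\<exists>a\<in>A. norm (v - a) \<le> 1 / real m" if v: "norm v = 1" for v
    proof
      let ?a = "inv_into S2 r (r v)"
      have "v \<in> S2" using v by simp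
      then show "?a \<in> A" by (auto simp: A_def)
      have "r ?a = r v" using \<open>v \<in> S2\<close> by (intro f_inv_into_f) auto
      then have fl: "\<lfloor>3 * real m * ?a $ i\<rfloor> = \<lfloor>3 * real m * v $ i\<rfloor>" for i :: 3
        using exhaust_3[of i] by (auto simp: r_def)
      have "\<bar>(v - ?a) $ i\<bar> \<le> 1 / (3 * real m)" for i :: 3
      proof -
        have "\<bar>3 * real m * v $ i - 3 * real m * ?a $ i\<bar> \<le> 1"
          using fl[of i] by linarith
        then have "3 * real m * \<bar>(v - ?a) $ i\<bar> \<le> 1"
          using m by (simp add: abs_mult[symmetric] right_diff_distrib[symmetric] del: abs_mult)
        then show ?thesis using m by (simp add: field_simps)
      qed
      then have "(\<Sum>i\<in>UNIV. \<bar>(v - ?a) $ i\<bar>) \<le> (\<Sum>i\<in>(UNIV :: 3 set). 1 / (3 * real m))"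
        by (intro sum_mono)
      then have "(\<Sum>i\<in>UNIV. \<bar>(v - ?a) $ i\<bar>) \<le> 1 / real m" by simp
      then show "norm (v - ?a) \<le> 1 / real m"
        using norm_le_l1_cart[of "v - ?a"] by linarith
    qed
  qed
qed

text \<open>Replacing the axis by a net point changes inner products on the sphere by at most
  \<open>1 / n\<close>. Moving the threshold outwards or inwards by between \<open>1 / n\<close> and
  \<open>2 / n\<close> compensates for this and lands on the grid. The relative area changes by at
  most \<open>1 / n\<close>, hence the expected count by at most 1. In \<open>main\<close> the set
  \<open>H\<close> lies between the open and the closed half-space so that both kinds of cap are
  covered.\<close>

lemma cap_discrepancy_le_net:
  assumes x: "\<And>j. j < n \<Longrightarrow> x j \<in> S2" and n: "2 \<le> n"
    and A: "\<And>a. a \<in> A \<Longrightarrow> norm a = 1" "\<And>v. norm v = 1 \<Longrightarrow> \<exists>a\<in>A. norm (v - a) \<le> 1 / real n"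
    and dev: "\<And>a i. a \<in> A \<Longrightarrow> i \<in> {- 2 * int n..2 * int n} \<Longrightarrow>
      \<bar>(\<Sum>j<n. indicator {x. a \<bullet> x \<le> of_int i / real n} (x j)) - real n * cap_fraction (of_int i / real n)\<bar> \<le> u"
    and u: "0 \<le> u"
  shows "cap_discrepancy n x \<le> u + 1"
proof -
  define N where "N H = (\<Sum>j<n. indicator H (x j) :: real)" for H
  have N_bounds: "0 \<le> N H" "N H \<le> real n" for H
    unfolding N_def using sum_mono[of "{..<n}" "\<lambda>j. indicator H (x j) :: real" "\<lambda>_. 1"]
    by (auto simp: sum_nonneg indicator_le_1)
  have N_mono: "N H \<le> N H'" if "\<And>y. y \<in> S2 \<Longrightarrow> y \<in> H \<Longrightarrow> y \<in> H'" for H H'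
    unfolding N_def using x that by (intro sum_mono) (auto simp: indicator_def)
  have main: "\<bar>N H - real n * cap_fraction b\<bar> \<le> u + 1"
    if a: "norm a = 1" and H: "{x. a \<bullet> x < b} \<subseteq> H" "H \<subseteq> {x. a \<bullet> x \<le> b}" for a b H
  proof -
    have ax: "\<bar>a \<bullet> y\<bar> \<le> 1" if "y \<in> S2" for y
      using Cauchy_Schwarz_ineq2[of a y] a that by simp
    \<comment> \<open>Thresholds outside \<open>[-1, 1]\<close> could leave the index range of the
      net, but there the cap is empty or the whole sphere and the deviation is 0.\<close>
    consider "b < -1" | "1 < b" | "-1 \<le> b" "b \<le> 1" by linarith
    then show ?thesis
    proof cases
      case 1
      have "N H \<le> N {}" using ax H(2) 1 by (intro N_mono) (fastforce simp: abs_le_iff)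
      then have "N H = 0" using N_bounds[of H] by (simp add: N_def)
      then show ?thesis using 1 u by (simp add: cap_fraction_def)
    next
      case 2
      have "N UNIV \<le> N H" using ax H(1) 2 by (intro N_mono) (fastforce simp: abs_le_iff)
      then have "N H = real n" using N_bounds[of H] by (simp add: N_def)
      then show ?thesis using 2 u by (simp add: cap_fraction_def)
    next
      case 3
      obtain a' where a': "a' \<in> A" "norm (a - a') \<le> 1 / real n" using A(2)[OF a] by blast
      have near: "\<bar>a \<bullet> y - a' \<bullet> y\<bar> \<le> 1 / real n" if "y \<in> S2" for y
        using Cauchy_Schwarz_ineq2[of "a - a'" y] a'(2) that by (simp add: inner_diff_left)
      have nb: "- real n \<le> real n * b" "real n * b \<le> real n"
        using 3 mult_left_mono[of "-1" b "real n"] mult_left_mono[of b 1 "real n"] by auto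
      \<comment> \<open>Grid indices for the outer and the inner cap. The inner one must lie
        strictly below \<open>real n * b - 1\<close>, so that its closed cap is contained in the
        open one. Both stay within \<open>2 * int n\<close> in modulus because \<open>n\<close> is
        at least 2.\<close>
      define i where "i = \<lceil>real n * b\<rceil> + 1"
      define k where "k = \<lceil>real n * b\<rceil> - 2"
      have i: "real n * b + 1 \<le> of_int i" "of_int i \<le> real n * b + 2" unfolding i_def by linarith+
      have k: "of_int k < real n * b - 1" "real n * b - 2 \<le> of_int k" unfolding k_def by linarith+
      have ik: "i \<in> {- 2 * int n..2 * int n}" "k \<in> {- 2 * int n..2 * int n}"
      proof -
        have "2 \<le> real n" "real_of_int (2 * int n) = 2 * real n" "real_of_int (- 2 * int n) = - 2 * real n"
          using n by auto
        then have "real_of_int i \<le> real_of_int (2 * int n)" "real_of_int (- 2 * int n) \<le> real_of_int i"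
          "real_of_int k \<le> real_of_int (2 * int n)" "real_of_int (- 2 * int n) \<le> real_of_int k"
          using i k nb by linarith+
        then show "i \<in> {- 2 * int n..2 * int n}" "k \<in> {- 2 * int n..2 * int n}"
          by (simp_all only: of_int_le_iff atLeastAtMost_iff)
      qed
      let ?b = "of_int i / real n" and ?c = "of_int k / real n"
      have b: "b + 1 / real n \<le> ?b" "?b \<le> b + 2 / real n" "?c < b - 1 / real n" "b - 2 / real n \<le> ?c"
      proof -
        have e: "(real n * b + c) / real n = b + c / real n" for c
          using n by (simp add: add_divide_distrib)
        have "(real n * b + 1) / real n \<le> ?b" "?b \<le> (real n * b + 2) / real n"
          "?c < (real n * b + - 1) / real n" "(real n * b + - 2) / real n \<le> ?c"
          using i k n by (simp_all add: divide_right_mono divide_strict_right_mono)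
        then show "b + 1 / real n \<le> ?b" "?b \<le> b + 2 / real n" "?c < b - 1 / real n" "b - 2 / real n \<le> ?c"
          unfolding e by simp_all
      qed
      have "N H \<le> N {x. a' \<bullet> x \<le> ?b}"
        using near H(2) b(1) by (intro N_mono) (fastforce simp: abs_le_iff)
      also have "\<dots> \<le> real n * cap_fraction ?b + u"
        using dev[OF a'(1) ik(1)] unfolding N_def by linarith
      also have "cap_fraction ?b \<le> cap_fraction b + (2 / real n) / 2"
        using cap_fraction_mono[OF b(2)] cap_fraction_add_le[of "2 / real n" b] by simp
      finally have upper: "N H \<le> real n * cap_fraction b + 1 + u"
        using n by (simp add: distrib_left)
      have "N {x. a' \<bullet> x \<le> ?c} \<le> N H"
        using near H(1) b(3) by (intro N_mono) (fastforce simp: abs_le_iff)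
      moreover have "real n * cap_fraction ?c - u \<le> N {x. a' \<bullet> x \<le> ?c}"
        using dev[OF a'(1) ik(2)] unfolding N_def by linarith
      moreover have "cap_fraction b \<le> cap_fraction ?c + (2 / real n) / 2"
        using cap_fraction_mono[of b "?c + 2 / real n"] b(4) cap_fraction_add_le[of "2 / real n" ?c] by simp
      then have "real n * cap_fraction b \<le> real n * (cap_fraction ?c + (2 / real n) / 2)"
        by (intro mult_left_mono) auto
      then have "real n * cap_fraction b \<le> real n * cap_fraction ?c + 1"
        using n by (simp add: distrib_left)
      ultimately show ?thesis using upper by linarith
    qed
  qed
  show ?thesis
    unfolding cap_discrepancy_le_iff
  proof
    fix D assume "D \<in> spherical_caps"
    then show "cap_deviation n x D \<le> u + 1"
    proof (cases rule: spherical_caps_cases)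
      case (1 a b)
      have "\<bar>N {x. a \<bullet> x \<le> b} - real n * cap_fraction b\<bar> \<le> u + 1"
        by (rule main[OF 1(1)]) auto
      then show ?thesis
        unfolding 1(2) by (subst cap_deviation_unit(1)[OF 1(1) x]) (simp_all only: N_def)
    next
      case (2 a b)
      have "\<bar>N {x. a \<bullet> x < b} - real n * cap_fraction b\<bar> \<le> u + 1"
        by (rule main[OF 2(1)]) auto
      then show ?thesis
        unfolding 2(2) by (subst cap_deviation_unit(2)[OF 2(1) x]) (simp_all only: N_def)
    qed
  qed
qed

section \<open>Measurability of the discrepancy\<close>

lemma measure_open_cap:
  assumes "a \<noteq> 0"
  shows "measure area_S2 (S2 \<inter> {x. a \<bullet> x < b}) = 4 * pi * cap_fraction (b / norm a)"
    and "measure area_S2 (S2 \<inter> {x. a \<bullet> x \<le> b}) = 4 * pi * cap_fraction (b / norm a)"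
proof -
  have n: "norm (a /\<^sub>R norm a) = 1" using assms by simp
  show "measure area_S2 (S2 \<inter> {x. a \<bullet> x < b}) = 4 * pi * cap_fraction (b / norm a)"
    "measure area_S2 (S2 \<inter> {x. a \<bullet> x \<le> b}) = 4 * pi * cap_fraction (b / norm a)"
    unfolding halfspace_normalize[OF assms] by (rule measure_cap[OF n])+
qed

text \<open>Rational open half-spaces approximate a given half-space from outside if it is closed and
  from inside if it is open.\<close>
lemma cap_deviation_le_countable:
  assumes Q: "\<And>X. open X \<Longrightarrow> X \<noteq> {} \<Longrightarrow> \<exists>d\<in>Q. d \<in> X"
    and dev: "\<And>a b. a \<in> Q \<Longrightarrow> a \<noteq> 0 \<Longrightarrow> b \<in> \<rat> \<Longrightarrow> cap_deviation n x (S2 \<inter> {x. a \<bullet> x < b}) \<le> u"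
    and a: "a \<noteq> 0" and x: "\<And>j. j < n \<Longrightarrow> x j \<in> S2"
    and H: "H = {x. a \<bullet> x \<le> b} \<or> H = {x. a \<bullet> x < b}"
  shows "cap_deviation n x (S2 \<inter> H) \<le> u"
proof -
  define e where "e k = 1 / real (Suc k)" for k
  have e: "0 < e k" for k by (simp add: e_def)
  have e0: "e \<longlonglongrightarrow> 0" unfolding e_def by (rule LIMSEQ_Suc[OF lim_1_over_n])
  have "\<forall>k. \<exists>c. c \<in> Q \<and> c \<noteq> 0 \<and> norm (c - a) < e k"
  proof
    fix k
    have "ball a (min (e k) (norm a)) \<noteq> {}" using e[of k] a by (simp add: not_le)
    then obtain c where c: "c \<in> Q" "c \<in> ball a (min (e k) (norm a))" using Q by blast
    then have "norm (c - a) < e k" "norm (c - a) < norm a" by (auto simp: dist_norm norm_minus_commute)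
    moreover from this have "c \<noteq> 0" by auto
    ultimately show "\<exists>c. c \<in> Q \<and> c \<noteq> 0 \<and> norm (c - a) < e k" using c(1) by blast
  qed
  then obtain A where A: "\<And>k. A k \<in> Q" "\<And>k. A k \<noteq> 0" "\<And>k. norm (A k - a) < e k" by metis
  \<comment> \<open>The threshold is shifted by more than \<open>e k\<close>, the bound on the error
    of \<open>A k \<bullet> y\<close> for \<open>y\<close> on the sphere. Points with
    \<open>a \<bullet> y = b\<close> therefore fall inside the approximating cap when
    \<open>H\<close> is closed and outside when \<open>H\<close> is open, for every
    \<open>k\<close>.\<close>
  define lo where "lo k = (if H = {x. a \<bullet> x \<le> b} then b + e k else b - 2 * e k)" for k
  have "\<forall>k. \<exists>r\<in>\<rat>. lo k < r \<and> r < lo k + e k"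
    using Rats_dense_in_real e by (metis less_add_same_cancel1)
  then obtain B where B: "\<And>k. B k \<in> \<rat>" "\<And>k. lo k < B k" "\<And>k. B k < lo k + e k" by metis
  have lim_lo: "lo \<longlonglongrightarrow> b"
  proof (cases "H = {x. a \<bullet> x \<le> b}")
    case True
    have "(\<lambda>k. b + e k) \<longlonglongrightarrow> b + 0" by (intro tendsto_intros e0)
    with True show ?thesis by (simp add: lo_def[abs_def])
  next
    case False
    have "(\<lambda>k. b - 2 * e k) \<longlonglongrightarrow> b - 2 * 0" by (intro tendsto_intros e0)
    with False show ?thesis by (simp add: lo_def[abs_def])
  qed
  have lim_B: "B \<longlonglongrightarrow> b"
  proof (rule tendsto_sandwich[OF _ _ lim_lo])
    have "(\<lambda>k. lo k + e k) \<longlonglongrightarrow> b + 0" by (intro tendsto_add lim_lo e0)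
    then show "(\<lambda>k. lo k + e k) \<longlonglongrightarrow> b" by simp
  qed (simp_all add: less_imp_le B(2,3))
  have lim_A: "A \<longlonglongrightarrow> a"
  proof -
    have "(\<lambda>k. A k - a) \<longlonglongrightarrow> 0"
      by (intro Lim_null_comparison[OF _ e0]) (simp add: less_imp_le A(3))
    then show ?thesis by (simp add: LIM_zero_cancel)
  qed
  have ind: "\<forall>\<^sub>F k in sequentially. indicator (S2 \<inter> {x. A k \<bullet> x < B k}) y = (indicator (S2 \<inter> H) y :: real)"
    if y: "y \<in> S2" for y
  proof -
    have near: "\<bar>A k \<bullet> y - a \<bullet> y\<bar> < e k" for k
      using Cauchy_Schwarz_ineq2[of "A k - a" y] A(3)[of k] y by (simp add: inner_diff_left)
    have lim_y: "(\<lambda>k. A k \<bullet> y) \<longlonglongrightarrow> a \<bullet> y"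
      by (intro tendsto_intros lim_A)
    consider "a \<bullet> y < b" | "a \<bullet> y = b" | "b < a \<bullet> y" by linarith
    then have "\<forall>\<^sub>F k in sequentially. A k \<bullet> y < B k \<longleftrightarrow> y \<in> H"
    proof cases
      case 1
      then have "y \<in> H" using H by auto
      obtain c where c: "a \<bullet> y < c" "c < b" using 1 dense by blast
      from order_tendstoD(2)[OF lim_y c(1)] order_tendstoD(1)[OF lim_B c(2)]
      show ?thesis
        by eventually_elim (use \<open>y \<in> H\<close> in auto)
    next
      case 3
      then have "y \<notin> H" using H by auto
      obtain c where c: "b < c" "c < a \<bullet> y" using 3 dense by blast
      from order_tendstoD(1)[OF lim_y c(2)] order_tendstoD(2)[OF lim_B c(1)]
      show ?thesis
        by eventually_elim (use \<open>y \<notin> H\<close> in auto)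
    next
      case 2
      have "A k \<bullet> y < B k \<longleftrightarrow> y \<in> H" for k
      proof (cases "H = {x. a \<bullet> x \<le> b}")
        case True
        then show ?thesis using 2 near[of k] B(2)[of k] by (auto simp: lo_def)
      next
        case False
        then have "y \<notin> H" using H 2 by auto
        with False show ?thesis using 2 near[of k] B(3)[of k] by (auto simp: lo_def)
      qed
      then show ?thesis by simp
    qed
    then show ?thesis
      by eventually_elim (use y in \<open>simp add: indicator_def\<close>)
  qed
  have "(\<lambda>k. \<Sum>j<n. indicator (S2 \<inter> {x. A k \<bullet> x < B k}) (x j) :: real) \<longlonglongrightarrow> (\<Sum>j<n. indicator (S2 \<inter> H) (x j))"
    using ind x by (intro tendsto_sum tendsto_eventually) auto
  moreover have "(\<lambda>k. measure area_S2 (S2 \<inter> {x. A k \<bullet> x < B k})) \<longlonglongrightarrow> measure area_S2 (S2 \<inter> H)"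
  proof -
    have "measure area_S2 (S2 \<inter> H) = 4 * pi * cap_fraction (b / norm a)"
      using H measure_open_cap[OF a] by auto
    moreover have "(\<lambda>k. 4 * pi * cap_fraction (B k / norm (A k))) \<longlonglongrightarrow> 4 * pi * cap_fraction (b / norm a)"
      using a by (intro tendsto_intros tendsto_cap_fraction lim_A lim_B) simp
    ultimately show ?thesis
      by (simp only: measure_open_cap(1)[OF A(2)])
  qed
  ultimately have "(\<lambda>k. cap_deviation n x (S2 \<inter> {x. A k \<bullet> x < B k})) \<longlonglongrightarrow> cap_deviation n x (S2 \<inter> H)"
    unfolding cap_deviation_def by (intro tendsto_rabs tendsto_diff tendsto_divide tendsto_mult tendsto_const) auto
  then show ?thesis
    by (rule LIMSEQ_le_const2) (auto intro!: dev A B)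
qed

text \<open>A set outside \<open>sets \<Omega>\<close> has \<open>measure\<close> 0 by convention,
  so a lower bound on the probability of this event depends on its measurability. Countably many
  open caps, with axes in a dense set and rational thresholds, suffice to test the supremum.\<close>

lemma sets_cap_discrepancy_le:
  assumes P: "\<And>i. i < n \<Longrightarrow> P i \<in> \<Omega> \<rightarrow>\<^sub>M area_S2"
  shows "{\<omega> \<in> space \<Omega>. cap_discrepancy n (\<lambda>i. P i \<omega>) \<le> u} \<in> sets \<Omega>"
proof -
  obtain Q :: "(real^3) set" where Q: "countable Q" "\<And>X. open X \<Longrightarrow> X \<noteq> {} \<Longrightarrow> \<exists>d\<in>Q. d \<in> X"
    using countable_dense_setE by blast
  let ?R = "(Q - {0}) \<times> (\<rat> :: real set)"
  have x: "P i \<omega> \<in> S2" if "i < n" "\<omega> \<in> space \<Omega>" for i \<omega>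
    using measurable_space[OF P] that by (simp add: space_area_S2)
  have iff: "cap_discrepancy n (\<lambda>i. P i \<omega>) \<le> u \<longleftrightarrow>
      (\<forall>c\<in>?R. cap_deviation n (\<lambda>i. P i \<omega>) (S2 \<inter> {x. fst c \<bullet> x < snd c}) \<le> u)"
    if \<omega>: "\<omega> \<in> space \<Omega>" for \<omega>
    unfolding cap_discrepancy_le_iff
  proof (intro iffI ballI)
    fix c assume all: "\<forall>D\<in>spherical_caps. cap_deviation n (\<lambda>i. P i \<omega>) D \<le> u" and "c \<in> ?R"
    then have "fst c \<noteq> 0" by auto
    then have "S2 \<inter> {x. fst c \<bullet> x < snd c} \<in> spherical_caps"
      unfolding spherical_caps_def halfspaces_def by blast
    with all show "cap_deviation n (\<lambda>i. P i \<omega>) (S2 \<inter> {x. fst c \<bullet> x < snd c}) \<le> u"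
      by blast
  next
    fix D assume all: "\<forall>c\<in>?R. cap_deviation n (\<lambda>i. P i \<omega>) (S2 \<inter> {x. fst c \<bullet> x < snd c}) \<le> u"
      and "D \<in> spherical_caps"
    then obtain a b H where "a \<noteq> 0" "H = {x. a \<bullet> x \<le> b} \<or> H = {x. a \<bullet> x < b}" "D = S2 \<inter> H"
      unfolding spherical_caps_def halfspaces_def by blast
    moreover have "cap_deviation n (\<lambda>i. P i \<omega>) (S2 \<inter> {x. a \<bullet> x < b}) \<le> u" if "a \<in> Q" "a \<noteq> 0" "b \<in> \<rat>" for a b
      using all that by force
    ultimately show "cap_deviation n (\<lambda>i. P i \<omega>) D \<le> u"
      using cap_deviation_le_countable[OF Q(2), of n "\<lambda>i. P i \<omega>" u a H b] x[OF _ \<omega>] by simp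
  qed
  have meas: "(\<lambda>\<omega>. cap_deviation n (\<lambda>i. P i \<omega>) (S2 \<inter> {x. a \<bullet> x < b})) \<in> borel_measurable \<Omega>" for a b
  proof -
    have ind: "indicator (S2 \<inter> {x. a \<bullet> x < b}) \<in> borel_measurable area_S2"
      by (rule borel_measurable_indicator[OF sets_area_S2_halfspace(2)])
    have "(\<lambda>\<omega>. \<Sum>j<n. indicator (S2 \<inter> {x. a \<bullet> x < b}) (P j \<omega>) :: real) \<in> borel_measurable \<Omega>"
      by (intro borel_measurable_sum measurable_compose[OF P ind]) simp
    then show ?thesis unfolding cap_deviation_def by measurable
  qed
  have "countable ?R" using Q(1) countable_rat by blast
  then have "{\<omega> \<in> space \<Omega>. \<forall>c\<in>?R. cap_deviation n (\<lambda>i. P i \<omega>) (S2 \<inter> {x. fst c \<bullet> x < snd c}) \<le> u} \<in> sets \<Omega>"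
    by (intro sets.sets_Collect_countable_All' borel_measurable_le meas borel_measurable_const)
  also have "{\<omega> \<in> space \<Omega>. \<forall>c\<in>?R. cap_deviation n (\<lambda>i. P i \<omega>) (S2 \<inter> {x. fst c \<bullet> x < snd c}) \<le> u} =
      {\<omega> \<in> space \<Omega>. cap_discrepancy n (\<lambda>i. P i \<omega>) \<le> u}"
    by (intro Collect_cong conj_cong refl) (simp only: iff)
  finally show ?thesis .
qed

section \<open>Union bound over the net\<close>

theorem theorem1p1:
  fixes M :: real
  assumes "M > 0"
  shows "\<exists>C>0. \<forall>n\<ge>2. \<forall>(\<Omega> :: 'a measure) (P :: nat \<Rightarrow> 'a \<Rightarrow> real^3).
           spherical_ensemble n \<Omega> P \<longrightarrow>
           measure \<Omega> {\<omega> \<in> space \<Omega>.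
             cap_discrepancy n (\<lambda>i. P i \<omega>) \<le> C * real n powr (1/4) * sqrt (ln (real n))}
           \<ge> 1 - 1 / real n powr M"
\<comment> \<open>With \<open>C = 4 * (M + 16)\<close> each cap of the net fails with probability at
  most \<open>2 * real n powr (- M - 16)\<close>, and the net has at most
  \<open>real n ^ 16 / 2\<close> caps. The summand 2 absorbs the one point lost in passing to
  arbitrary caps.\<close>
proof (intro exI[of _ "4 * (M + 16) + 2"] conjI allI impI)
  show "0 < 4 * (M + 16) + 2" using assms by simp
  fix n :: nat and \<Omega> :: "'a measure" and P :: "nat \<Rightarrow> 'a \<Rightarrow> real^3"
  assume n: "2 \<le> n" and ens: "spherical_ensemble n \<Omega> P"
  interpret prob_space \<Omega> using ens by (simp add: spherical_ensemble_def)
  define C where "C = 4 * (M + 16)"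
  define s where "s = real n powr (1/4) * sqrt (ln (real n))"
  define u where "u = C * real n powr (1/4) * sqrt (ln (real n))"
  have C: "1 \<le> C" using assms by (simp add: C_def)
  \<comment> \<open>Ensures \<open>1 \<le> 2 * s\<close>, so that the additive 1 of
    \<open>cap_discrepancy_le_net\<close> fits into the constant; the worst case is
    \<open>n = 2\<close>.\<close>
  have s: "1 / 2 \<le> s"
  proof -
    have "1 - 1 / 2 \<le> ln (2::real)" using ln_le_minus_one[of "1 / 2"] by (simp add: ln_div)
    also have "\<dots> \<le> ln (real n)" using n by simp
    finally have "sqrt ((1 / 2)\<^sup>2) \<le> sqrt (ln (real n))"
      by (intro real_sqrt_le_mono) (simp add: power2_eq_square)
    moreover have "1 \<le> real n powr (1/4)" using n by (intro ge_one_powr_ge_zero) auto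
    ultimately have "1 * (1 / 2) \<le> s"
      unfolding s_def by (intro mult_mono) auto
    then show ?thesis by simp
  qed
  have u: "u = C * s" by (simp add: u_def s_def)
  obtain A :: "(real^3) set" where A: "finite A" "card A \<le> (6 * n + 1) ^ 3" "\<And>a. a \<in> A \<Longrightarrow> norm a = 1"
    "\<And>v. norm v = 1 \<Longrightarrow> \<exists>a\<in>A. norm (v - a) \<le> 1 / real n"
    using sphere_net[of n] n by auto
  let ?I = "{- 2 * int n..2 * int n}"
  define bad where "bad c = {\<omega> \<in> space \<Omega>. u < \<bar>(\<Sum>j<n. indicator {x. fst c \<bullet> x \<le> of_int (snd c) / real n} (P j \<omega>))
     - real n * cap_fraction (of_int (snd c) / real n)\<bar>}" for c :: "(real^3) \<times> int"
  let ?good = "{\<omega> \<in> space \<Omega>. cap_discrepancy n (\<lambda>i. P i \<omega>) \<le> (C + 2) * real n powr (1/4) * sqrt (ln (real n))}"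
  have good_sets: "?good \<in> sets \<Omega>"
    using spherical_ensemble_points(1)[OF ens] by (rule sets_cap_discrepancy_le)
  have bad_sets: "bad c \<in> sets \<Omega>" for c
  proof -
    have ind: "(\<lambda>x. indicator {x. fst c \<bullet> x \<le> of_int (snd c) / real n} x :: real) \<in> borel_measurable area_S2"
      by (rule measurable_area_S2_borel) measurable
    have "(\<lambda>\<omega>. \<Sum>j<n. indicator {x. fst c \<bullet> x \<le> of_int (snd c) / real n} (P j \<omega>) :: real) \<in> borel_measurable \<Omega>"
      by (intro borel_measurable_sum measurable_compose[OF spherical_ensemble_points(1)[OF ens] ind]) simp
    then show ?thesis unfolding bad_def by measurable
  qed
  have fin: "finite (A \<times> ?I)" using A(1) by simp
  have sub: "space \<Omega> - ?good \<subseteq> (\<Union>c\<in>A \<times> ?I. bad c)"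
  proof (rule subsetI, rule ccontr)
    fix \<omega> assume \<omega>: "\<omega> \<in> space \<Omega> - ?good" and "\<omega> \<notin> (\<Union>c\<in>A \<times> ?I. bad c)"
    then have dev: "\<bar>(\<Sum>j<n. indicator {x. a \<bullet> x \<le> of_int i / real n} (P j \<omega>)) - real n * cap_fraction (of_int i / real n)\<bar> \<le> u"
      if "a \<in> A" "i \<in> ?I" for a i
      using that by (fastforce simp: bad_def)
    have "cap_discrepancy n (\<lambda>i. P i \<omega>) \<le> u + 1"
      using \<omega> C s u by (intro cap_discrepancy_le_net[OF spherical_ensemble_points(2)[OF ens] n A(3,4) dev]) auto
    also have "\<dots> \<le> (C + 2) * real n powr (1/4) * sqrt (ln (real n))"
      using s unfolding u by (simp add: s_def algebra_simps)
    finally show False using \<omega> by simp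
  qed
  have "measure \<Omega> (space \<Omega> - ?good) \<le> measure \<Omega> (\<Union>c\<in>A \<times> ?I. bad c)"
    using sub bad_sets fin by (intro finite_measure_mono sets.finite_UN) auto
  also have "\<dots> \<le> (\<Sum>c\<in>A \<times> ?I. measure \<Omega> (bad c))"
    using fin bad_sets by (intro finite_measure_subadditive_finite) auto
  also have "\<dots> \<le> (\<Sum>c\<in>A \<times> ?I. 2 * real n powr (- C / 4))"
    using spherical_ensemble_cap_concentration[OF ens A(3) n C] by (intro sum_mono) (auto simp: bad_def u_def)
  also have "\<dots> = real (card A * (4 * n + 1)) * (2 * real n powr (- C / 4))"
    by (simp add: card_cartesian_product nat_add_distrib nat_mult_distrib)
  also have "\<dots> \<le> real n ^ 16 / 2 * (2 * real n powr (- C / 4))"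
  proof (rule mult_right_mono)
    have "card A * (4 * n + 1) \<le> (7 * n) ^ 3 * (5 * n)"
      using n by (intro mult_mono order.trans[OF A(2)] power_mono) auto
    then have "2 * (card A * (4 * n + 1)) \<le> 3430 * n ^ 4"
    proof -
      have "(7 * n) ^ 3 * (5 * n) = 1715 * n ^ 4"
        by (simp add: power_mult_distrib power3_eq_cube power4_eq_xxxx)
      with \<open>card A * (4 * n + 1) \<le> (7 * n) ^ 3 * (5 * n)\<close> show ?thesis by linarith
    qed
    \<comment> \<open>The numerical factor 3430 is below \<open>2 ^ 12\<close>, hence below
      \<open>n ^ 12\<close>. Trading it for a power of \<open>n\<close> explains the 16 in the
      constant.\<close>
    also have "\<dots> \<le> n ^ 12 * n ^ 4"
      using power_mono[OF n, of 12] by (intro mult_right_mono) auto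
    also have "\<dots> = n ^ 16" by (simp add: power_add[symmetric])
    finally have "real (2 * (card A * (4 * n + 1))) \<le> real (n ^ 16)" by (simp only: of_nat_le_iff)
    then show "real (card A * (4 * n + 1)) \<le> real n ^ 16 / 2" by simp
  qed simp
  also have "\<dots> = real n powr (- M)"
  proof -
    have "- C / 4 = - M - 16" by (simp add: C_def field_simps)
    then have "real n powr (- C / 4) = real n powr (- M) / real n ^ 16"
      using n by (simp add: powr_diff)
    then show ?thesis using n by simp
  qed
  also have "\<dots> = 1 / real n powr M"
    by (simp add: powr_minus_divide)
  finally have "1 - 1 / real n powr M \<le> measure \<Omega> ?good"
    using prob_compl[OF good_sets] by simp
  then show "1 - 1 / real n powr M \<le> measure \<Omega> {\<omega> \<in> space \<Omega>.
      cap_discrepancy n (\<lambda>i. P i \<omega>) \<le> (4 * (M + 16) + 2) * real n powr (1/4) * sqrt (ln (real n))}"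
    by (simp only: C_def)
qed

end
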